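(* Let $n\ge 1$ and $\vec p=(p_1,\ldots,p_n)$ with $0<p_i<\infty$ for every $i$. If $0<t<\min(p_1,\ldots,p_n)$, then there is a constant $C>0$ independent of $f$ such that $$\|\mathcal M_t f\|_{\vec p}\le C\,\|f\|_{\vec p}$$ for all $f\in L^{\vec p}(\mathbb R^n)$.
   Context: $L^0(\mathbb R^n)$ is the set of (complex-valued) measurable functions on $\mathbb R^n$. For $\vec p=(p_1,\ldots,p_n)\in(0,\infty]^n$ the mixed Lebesgue norm is $$\|f\|_{\vec p}=\left(\int_{\mathbb R}\cdots\left(\int_{\mathbb R}\left(\int_{\mathbb R}|f(x_1,\ldots,x_n)|^{p_1}\,dx_1\right)^{p_2/p_1}dx_2\right)^{p_3/p_2}\cdots dx_n\right)^{1/p_n}$$ (essential suprema replacing integrals when $p_j=\infty$), and $L^{\vec p}(\mathbb R^n)=\{f\in L^0(\mathbb R^n):\|f\|_{\vec p}<\infty\}$. For $1\le k\le n$ the one-dimensional maximal operator in the $k$-th variable is $M_kf(x)=\sup_{I\ni x_k}\frac1{|I|}\int_I|f(x_1,\ldots,y_k,\ldots,x_n)|\,dy_k$, the supremum being over intervals $I\subset\mathbb R$ containing $x_k$. For $t>0$ the iterated maximal operator is $\mathcal M_tf(x)=\left(M_n\cdots M_1[|f|^t](x)\right)^{1/t}$. *)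

theory Defs
  imports "HOL-Analysis.Analysis"
begin

text \<open>
  Points of \<open>\<real>\<^sup>n\<close> are the functions in \<open>{1..n} \<rightarrow>\<^sub>E UNIV\<close>, so that the coordinates keep their
  order and \<open>x(k := y)\<close> replaces the \<open>k\<close>-th one. The measure is the completed product measure,
  i.e. Lebesgue measure, and measurability means Lebesgue measurability.
\<close>

definition lebesgue_pow :: "nat \<Rightarrow> (nat \<Rightarrow> real) measure" where
  "lebesgue_pow n = completion (PiM {1..n} (\<lambda>_. lborel))"

text \<open>Powers in \<open>[0, \<infinity>]\<close>; only exponents \<open>a > 0\<close> are meant.\<close>

definition epowr :: "ennreal \<Rightarrow> real \<Rightarrow> ennreal" where
  "epowr u a = (if u = \<infinity> then \<infinity> else ennreal (enn2real u powr a))"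

text \<open>
  All (quasi-)norms are defined on \<open>[0, \<infinity>]\<close>-valued functions, since maximal functions may take
  the value \<open>\<infinity>\<close>; a complex-valued \<open>f\<close> enters through \<open>|f|\<close>. For \<open>p = \<infinity>\<close> this is the
  essential supremum.
\<close>

definition Lp_norm1 :: "ennreal \<Rightarrow> (real \<Rightarrow> ennreal) \<Rightarrow> ennreal" where
  "Lp_norm1 p g =
    (if p = \<infinity> then Inf {c. AE y in lebesgue. g y \<le> c}
     else epowr (\<integral>\<^sup>+ y. epowr (g y) (enn2real p) \<partial>lebesgue) (1 / enn2real p))"

text \<open>
  The norm in \<open>x\<^sub>1\<close> is taken first (innermost). After \<open>k\<close> steps the result no longer depends on
  coordinates \<open>1, \<dots>, k\<close> of its argument. For finite exponents, raising the \<open>1/p\<^sub>k\<close>-th power of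
  step \<open>k\<close> to the power \<open>p\<^sub>k\<^sub>+\<^sub>1\<close> gives the exponent \<open>p\<^sub>k\<^sub>+\<^sub>1/p\<^sub>k\<close> of the usual formula.
\<close>

primrec partial_norm ::
  "nat \<Rightarrow> (nat \<Rightarrow> ennreal) \<Rightarrow> ((nat \<Rightarrow> real) \<Rightarrow> ennreal) \<Rightarrow> (nat \<Rightarrow> real) \<Rightarrow> ennreal" where
  "partial_norm 0 p g x = g x"
| "partial_norm (Suc k) p g x =
     Lp_norm1 (p (Suc k)) (\<lambda>y. partial_norm k p g (x(Suc k := y)))"

text \<open>
  The base point is the unique element of \<open>{} \<rightarrow>\<^sub>E UNIV\<close>: overwriting its coordinates
  \<open>1, \<dots>, n\<close> yields exactly the points of \<open>{1..n} \<rightarrow>\<^sub>E UNIV\<close>.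
\<close>

definition mixed_norm :: "nat \<Rightarrow> (nat \<Rightarrow> ennreal) \<Rightarrow> ((nat \<Rightarrow> real) \<Rightarrow> ennreal) \<Rightarrow> ennreal" where
  "mixed_norm n p g = partial_norm n p g (\<lambda>_. undefined)"

definition mixed_Lebesgue :: "nat \<Rightarrow> (nat \<Rightarrow> ennreal) \<Rightarrow> ((nat \<Rightarrow> real) \<Rightarrow> complex) set" where
  "mixed_Lebesgue n p =
    {f \<in> borel_measurable (lebesgue_pow n). mixed_norm n p (\<lambda>x. ennreal (cmod (f x))) < \<infinity>}"

text \<open>
  The intervals may be open, closed or half-open, with \<open>0 < |I| < \<infinity>\<close> so that the mean value
  over \<open>I\<close> makes sense.
\<close>

definition maximal_op ::
  "nat \<Rightarrow> ((nat \<Rightarrow> real) \<Rightarrow> ennreal) \<Rightarrow> (nat \<Rightarrow> real) \<Rightarrow> ennreal" where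
  "maximal_op k g x =
    (SUP I \<in> {I. is_interval I \<and> x k \<in> I \<and> 0 < emeasure lebesgue I \<and> emeasure lebesgue I < \<infinity>}.
       (\<integral>\<^sup>+ y \<in> I. g (x(k := y)) \<partial>lebesgue) / emeasure lebesgue I)"

text \<open>\<open>maximal_iter n g\<close> is \<open>M\<^sub>n (\<dots> (M\<^sub>1 g))\<close>.\<close>

primrec maximal_iter ::
  "nat \<Rightarrow> ((nat \<Rightarrow> real) \<Rightarrow> ennreal) \<Rightarrow> (nat \<Rightarrow> real) \<Rightarrow> ennreal" where
  "maximal_iter 0 g = g"
| "maximal_iter (Suc k) g = maximal_op (Suc k) (maximal_iter k g)"

definition iterated_maximal ::
  "nat \<Rightarrow> real \<Rightarrow> ((nat \<Rightarrow> real) \<Rightarrow> complex) \<Rightarrow> (nat \<Rightarrow> real) \<Rightarrow> ennreal" where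
  "iterated_maximal n t f x =
    epowr (maximal_iter n (\<lambda>z. ennreal (cmod (f z) powr t)) x) (1 / t)"

end

theory Submission
  imports Defs
begin

text \<open>
  Raising everything to the power \<open>t\<close> replaces the exponents \<open>p\<^sub>i\<close> by \<open>q\<^sub>i = p\<^sub>i / t > 1\<close> and
  reduces the claim to the boundedness of \<open>M\<^sub>n \<dots> M\<^sub>1\<close>, hence of each single \<open>M\<^sub>k\<close>, in the mixed norm
  with exponents \<open>q\<^sub>i\<close>. The norms in \<open>x\<^sub>1, \<dots>, x\<^sub>k\<^sub>-\<^sub>1\<close> are taken inside the one in \<open>x\<^sub>k\<close>, in which
  \<open>M\<^sub>k\<close> acts, so this is a maximal inequality on the line for functions with values in a mixed-norm
  space. The norms in \<open>x\<^sub>k\<^sub>+\<^sub>1, \<dots>, x\<^sub>n\<close> are monotone and homogeneous and cause no difficulty.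

  The vector-valued inequality follows from weighted scalar ones. Let \<open>G\<^sub>j\<close> and \<open>H\<^sub>j\<close> be the norms of
  \<open>M\<^sub>k h\<close> and \<open>h\<close> in the first \<open>j\<close> variables, as functions of \<open>x\<^sub>k\<close>. The induction over \<open>j < k\<close>
  (\<open>weighted_bound_norm_sections\<close>) shows that \<open>\<integral> G\<^sub>j\<^sup>r w \<le> N \<integral> H\<^sub>j\<^sup>r w\<close> for every \<open>r > 1\<close> and every
  Muckenhoupt weight \<open>w\<close> of the variable \<open>x\<^sub>k\<close>, with \<open>N\<close> independent of the other variables. For
  \<open>j = 0\<close> this is Muckenhoupt's theorem (\<open>muckenhoupt\<close>). For the step, take \<open>r = q\<^sub>j\<^sub>+\<^sub>1\<close> and integrate
  over \<open>x\<^sub>j\<^sub>+\<^sub>1\<close>: by Tonelli the same inequality holds for \<open>G\<^sub>j\<^sub>+\<^sub>1\<close> and \<open>H\<^sub>j\<^sub>+\<^sub>1\<close>, but only for this one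
  exponent. Rubio de Francia's extrapolation theorem (\<open>extrapolation\<close>), which concerns arbitrary
  pairs of functions, restores all exponents. Finally \<open>j = k - 1\<close>, \<open>w = 1\<close> and \<open>r = q\<^sub>k\<close> bound \<open>M\<^sub>k\<close>.

  A weight always enters through two \<open>A\<^sub>1\<close> weights \<open>u\<close> and \<open>v\<close>, as \<open>w = v u\<^sup>1\<^sup>-\<^sup>p\<close>; passing to the dual
  weight for the conjugate exponent just exchanges \<open>u\<close> and \<open>v\<close>. Muckenhoupt's theorem is obtained by
  Lerner's argument from the maximal functions of the measures \<open>w dx\<close> and \<open>w\<^sup>1\<^sup>-\<^sup>p\<^sup>' dx\<close>, which on the line
  are bounded for every \<open>\<sigma>\<close>-finite Borel measure (\<open>maxf_strong_type\<close>), because a finite family of intervals has a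
  subfamily with the same union and overlap at most two.

  Tonelli's theorem needs Borel functions, whereas \<open>f\<close> is only Lebesgue measurable. Changing \<open>f\<close> on a
  null set is harmless: a null set has null sections in the iterated sense, and this passes through
  the iterated norms as well as the iterated maximal operators.
\<close>

section \<open>Powers of extended nonnegative reals\<close>

lemma epowr_ennreal: "0 \<le> r \<Longrightarrow> epowr (ennreal r) a = ennreal (r powr a)"
  by (simp add: epowr_def)

lemma epowr_top [simp]: "epowr top a = top"
  by (simp add: epowr_def)

lemma epowr_0 [simp]: "epowr 0 a = 0"
  by (simp add: epowr_def)

lemma epowr_1 [simp]: "epowr 1 a = 1"
  using epowr_ennreal[of 1 a] by simp

lemma epowr_one [simp]: "epowr u 1 = u"
  by (cases u) (auto simp: epowr_ennreal)

lemma epowr_eq_0_iff [simp]: "epowr u a = 0 \<longleftrightarrow> u = 0"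
  by (cases u) (auto simp: epowr_ennreal)

lemma epowr_eq_top_iff [simp]: "epowr u a = top \<longleftrightarrow> u = top"
  by (cases u) (auto simp: epowr_ennreal)

lemma epowr_pos_iff [simp]: "0 < epowr u a \<longleftrightarrow> 0 < u"
  by (metis epowr_eq_0_iff zero_less_iff_neq_zero)

lemma epowr_less_top_iff [simp]: "epowr u a < top \<longleftrightarrow> u < top"
  by (metis epowr_eq_top_iff less_top)

lemma epowr_mono: "u \<le> v \<Longrightarrow> 0 \<le> a \<Longrightarrow> epowr u a \<le> epowr v a"
  by (cases u; cases v) (auto simp: epowr_ennreal powr_mono2 top_unique)

lemma epowr_epowr: "epowr (epowr u a) b = epowr u (a * b)"
  by (cases u) (auto simp: epowr_ennreal powr_powr)

lemma epowr_epowr_inverse [simp]: "a \<noteq> 0 \<Longrightarrow> epowr (epowr u a) (1 / a) = u"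
  by (simp add: epowr_epowr)

lemma epowr_inverse_epowr [simp]: "a \<noteq> 0 \<Longrightarrow> epowr (epowr u (1 / a)) a = u"
  by (simp add: epowr_epowr)

lemma epowr_mult: "epowr (u * v) a = epowr u a * epowr v a"
proof (cases "u = 0 \<or> v = 0 \<or> u = top \<or> v = top")
  case True
  then show ?thesis by (auto simp: ennreal_top_mult ennreal_mult_top)
next
  case False
  then obtain r s where "u = ennreal r" "0 \<le> r" "v = ennreal s" "0 \<le> s"
    by (metis ennreal_cases)
  then show ?thesis
    by (simp add: epowr_ennreal powr_mult flip: ennreal_mult)
qed

lemma epowr_add: "epowr u (a + b) = epowr u a * epowr u b"
  by (cases u) (auto simp: epowr_ennreal powr_add ennreal_mult)

lemma epowr_le_iff: "0 < a \<Longrightarrow> epowr u a \<le> v \<longleftrightarrow> u \<le> epowr v (1 / a)"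
  using epowr_mono[of "epowr u a" v "1/a"] epowr_mono[of u "epowr v (1/a)" a] by auto

lemma measurable_epowr [measurable (raw)]:
  assumes [measurable]: "f \<in> borel_measurable M"
  shows "(\<lambda>x. epowr (f x) a) \<in> borel_measurable M"
  unfolding epowr_def by measurable

text \<open>
  The layer-cake formula for a single number. It turns distributional estimates into
  estimates of \<open>p\<close>-th powers.
\<close>

lemma epowr_layer_cake:
  assumes a: "0 < a"
  shows "epowr u a =
    (\<integral>\<^sup>+ s. ennreal (a * s powr (a - 1)) * indicator {s. 0 < s \<and> ennreal s < u} s \<partial>lborel)"
proof -
  have Icc: "(\<integral>\<^sup>+ s. ennreal (a * s powr (a - 1)) * indicator {0..r} s \<partial>lborel) = ennreal (r powr a)"
    if "0 \<le> r" for r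
  proof -
    have "((\<lambda>s. a * s powr (a - 1)) has_integral (a * (r powr (a - 1 + 1) / (a - 1 + 1)))) {0..r}"
      using a that by (intro has_integral_mult_right has_integral_powr_from_0) auto
    then have "((\<lambda>s. a * s powr (a - 1)) has_integral (r powr a)) {0..r}"
      using a by simp
    from nn_integral_has_integral_lebesgue'[OF _ this] a show ?thesis by simp
  qed
  show ?thesis
  proof (cases u)
    case (real r)
    have "(\<integral>\<^sup>+ s. ennreal (a * s powr (a - 1)) * indicator {s. 0 < s \<and> ennreal s < u} s \<partial>lborel)
        = (\<integral>\<^sup>+ s. ennreal (a * s powr (a - 1)) * indicator {0..r} s \<partial>lborel)"
    proof (rule nn_integral_cong_AE)
      show "AE s in lborel. ennreal (a * s powr (a - 1)) * indicator {s. 0 < s \<and> ennreal s < u} s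
           = ennreal (a * s powr (a - 1)) * indicator {0..r} s"
        using AE_lborel_singleton[of 0] AE_lborel_singleton[of r]
        by eventually_elim (use real in \<open>auto simp: indicator_def ennreal_less_iff\<close>)
    qed
    then show ?thesis using Icc[of r] real by (simp add: epowr_ennreal)
  next
    case top
    have ge: "ennreal r \<le> (\<integral>\<^sup>+ s. ennreal (a * s powr (a - 1)) * indicator {s. 0 < s \<and> ennreal s < u} s \<partial>lborel)"
      (is "_ \<le> ?I") if "0 \<le> r" for r
    proof -
      have "ennreal r = (\<integral>\<^sup>+ s. ennreal (a * s powr (a - 1)) * indicator {0..r powr (1/a)} s \<partial>lborel)"
        using a that by (subst Icc) (auto simp: powr_powr)
      also have "\<dots> \<le> ?I"
      proof (rule nn_integral_mono_AE)
        show "AE s in lborel. ennreal (a * s powr (a - 1)) * indicator {0..r powr (1/a)} s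
          \<le> ennreal (a * s powr (a - 1)) * indicator {s. 0 < s \<and> ennreal s < u} s"
          using AE_lborel_singleton[of 0]
          by eventually_elim (use top in \<open>auto simp: indicator_def\<close>)
      qed
      finally show ?thesis .
    qed
    have "(\<integral>\<^sup>+ s. ennreal (a * s powr (a - 1)) * indicator {s. 0 < s \<and> ennreal s < u} s \<partial>lborel) = top"
    proof (cases "\<integral>\<^sup>+ s. ennreal (a * s powr (a - 1)) * indicator {s. 0 < s \<and> ennreal s < u} s \<partial>lborel")
      case (real r)
      with ge[of "r + 1"] show ?thesis by simp
    qed simp
    then show ?thesis using top by simp
  qed
qed

section \<open>The maximal function of a measure on the line\<close>

text \<open>
  Only open intervals with rational endpoints are used. They are countably many, so the maximal
  function is measurable and its level sets are countable unions of intervals.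
\<close>

definition maxf :: "real measure \<Rightarrow> (real \<Rightarrow> ennreal) \<Rightarrow> real \<Rightarrow> ennreal" where
  "maxf \<mu> g x = (SUP (a, b) \<in> \<rat> \<times> \<rat>. indicator {a<..<b} x *
     ((\<integral>\<^sup>+ y \<in> {a<..<b}. g y \<partial>\<mu>) / emeasure \<mu> {a<..<b}))"

lemma average_le_maxf:
  assumes "a \<in> \<rat>" "b \<in> \<rat>" "x \<in> {a<..<b}"
  shows "(\<integral>\<^sup>+ y \<in> {a<..<b}. g y \<partial>\<mu>) / emeasure \<mu> {a<..<b} \<le> maxf \<mu> g x"
  unfolding maxf_def using assms by (intro SUP_upper2[of "(a, b)"]) auto

lemma maxf_leI:
  assumes "\<And>a b. a \<in> \<rat> \<Longrightarrow> b \<in> \<rat> \<Longrightarrow> x \<in> {a<..<b} \<Longrightarrow>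
    (\<integral>\<^sup>+ y \<in> {a<..<b}. g y \<partial>\<mu>) / emeasure \<mu> {a<..<b} \<le> c"
  shows "maxf \<mu> g x \<le> c"
  unfolding maxf_def
proof (rule SUP_least, clarsimp)
  fix a b :: real assume "a \<in> \<rat>" "b \<in> \<rat>"
  with assms[of a b] show "indicator {a<..<b} x *
     ((\<integral>\<^sup>+ y \<in> {a<..<b}. g y \<partial>\<mu>) / emeasure \<mu> {a<..<b}) \<le> c"
    by (auto simp: indicator_def)
qed

lemma less_maxf_iff:
  "s < maxf \<mu> g x \<longleftrightarrow> (\<exists>a\<in>\<rat>. \<exists>b\<in>\<rat>. x \<in> {a<..<b} \<and>
     s < (\<integral>\<^sup>+ y \<in> {a<..<b}. g y \<partial>\<mu>) / emeasure \<mu> {a<..<b})"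
proof
  assume "s < maxf \<mu> g x"
  then show "\<exists>a\<in>\<rat>. \<exists>b\<in>\<rat>. x \<in> {a<..<b} \<and>
     s < (\<integral>\<^sup>+ y \<in> {a<..<b}. g y \<partial>\<mu>) / emeasure \<mu> {a<..<b}"
    using maxf_leI[of x \<mu> g s] by (meson not_le)
qed (use average_le_maxf less_le_trans in blast)

lemma measurable_maxf [measurable]:
  "maxf \<mu> g \<in> borel_measurable borel"
proof -
  have "countable (\<rat> \<times> \<rat> :: (real \<times> real) set)" 
    by (simp add: countable_rat)
  then show ?thesis unfolding maxf_def[abs_def] split_beta
    by (intro borel_measurable_SUP) auto
qed

lemma maxf_mono_AE:
  assumes "AE y in \<mu>. f y \<le> g y"
  shows "maxf \<mu> f x \<le> maxf \<mu> g x"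
proof (rule maxf_leI)
  fix a b :: real assume ab: "a \<in> \<rat>" "b \<in> \<rat>" "x \<in> {a<..<b}"
  have "(\<integral>\<^sup>+ y \<in> {a<..<b}. f y \<partial>\<mu>) \<le> (\<integral>\<^sup>+ y \<in> {a<..<b}. g y \<partial>\<mu>)"
    using assms by (intro nn_integral_mono_AE) (auto elim!: eventually_mono intro: mult_right_mono)
  then show "(\<integral>\<^sup>+ y \<in> {a<..<b}. f y \<partial>\<mu>) / emeasure \<mu> {a<..<b} \<le> maxf \<mu> g x"
    using average_le_maxf[OF ab] by (meson divide_right_mono_ennreal order_trans)
qed

lemma maxf_cmult:
  assumes [measurable]: "g \<in> borel_measurable \<mu>" and "sets \<mu> = sets borel"
  shows "maxf \<mu> (\<lambda>y. c * g y) x = c * maxf \<mu> g x"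
proof -
  note [measurable_cong] = assms(2)
  have "(\<integral>\<^sup>+ y \<in> {a<..<b}. c * g y \<partial>\<mu>) = c * (\<integral>\<^sup>+ y \<in> {a<..<b}. g y \<partial>\<mu>)" for a b
    by (subst nn_integral_cmult[symmetric]) (auto simp: ac_simps)
  then show ?thesis
    unfolding maxf_def SUP_mult_left_ennreal split_beta
    by (simp add: ac_simps ennreal_times_divide[symmetric])
qed

lemma maxf_suminf_le:
  assumes [measurable]: "\<And>k::nat. g k \<in> borel_measurable \<mu>" and "sets \<mu> = sets borel"
  shows "maxf \<mu> (\<lambda>y. \<Sum>k. g k y) x \<le> (\<Sum>k. maxf \<mu> (g k) x)"
proof (rule maxf_leI)
  note [measurable_cong] = assms(2)
  fix a b :: real assume ab: "a \<in> \<rat>" "b \<in> \<rat>" "x \<in> {a<..<b}"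
  have "(\<integral>\<^sup>+ y \<in> {a<..<b}. (\<Sum>k. g k y) \<partial>\<mu>) / emeasure \<mu> {a<..<b}
      = (\<Sum>k. (\<integral>\<^sup>+ y \<in> {a<..<b}. g k y \<partial>\<mu>) / emeasure \<mu> {a<..<b})"
    by (simp add: nn_integral_suminf flip: ennreal_suminf_multc)
  also have "\<dots> \<le> (\<Sum>k. maxf \<mu> (g k) x)"
    by (intro suminf_le average_le_maxf ab) auto
  finally show "(\<integral>\<^sup>+ y \<in> {a<..<b}. (\<Sum>k. g k y) \<partial>\<mu>) / emeasure \<mu> {a<..<b} \<le> (\<Sum>k. maxf \<mu> (g k) x)" .
qed

text \<open>
  The covering property special to the line: among three intervals with a common point,
  one with the smallest left endpoint and one with the largest right endpoint cover the third.
  A subfamily of minimal size with the same union therefore has overlap at most two.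
\<close>

lemma interval_cover_overlap_2:
  fixes F :: "(real \<times> real) set"
  defines "J \<equiv> \<lambda>i. {fst i<..<snd i}"
  assumes "finite F"
  obtains F' where "F' \<subseteq> F" "(\<Union>i\<in>F'. J i) = (\<Union>i\<in>F. J i)"
    "\<And>x. card {i \<in> F'. x \<in> J i} \<le> 2"
proof -
  define P where "P = (\<lambda>G. G \<subseteq> F \<and> (\<Union>i\<in>G. J i) = (\<Union>i\<in>F. J i))"
  have "P F" by (simp add: P_def)
  then obtain G where G: "P G" and min: "\<And>H. P H \<Longrightarrow> card G \<le> card H"
    using ex_has_least_nat[of P F card] by blast
  have fin: "finite G" using G assms finite_subset by (auto simp: P_def)
  have "card {i \<in> G. x \<in> J i} \<le> 2" for x
  proof (rule ccontr)
    define S where "S = {i \<in> G. x \<in> J i}"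
    assume "\<not> card {i \<in> G. x \<in> J i} \<le> 2"
    then have S: "card S > 2" "finite S" using fin by (auto simp: S_def)
    then have "S \<noteq> {}" by auto
    have "Min (fst ` S) \<in> fst ` S" "Max (snd ` S) \<in> snd ` S"
      using S \<open>S \<noteq> {}\<close> by (auto intro!: Min_in Max_in)
    then obtain l u where "l \<in> S" "fst l = Min (fst ` S)" "u \<in> S" "snd u = Max (snd ` S)"
      by (metis imageE)
    then have l: "l \<in> S" "\<And>i. i \<in> S \<Longrightarrow> fst l \<le> fst i"
      and u: "u \<in> S" "\<And>i. i \<in> S \<Longrightarrow> snd i \<le> snd u"
      using S by auto
    have "card {l, u} \<le> 2" by (simp add: card_insert_if)
    then have "\<not> S \<subseteq> {l, u}" using S by (meson card_mono finite.emptyI finite_insert leD order_trans)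
    then obtain j where j: "j \<in> S" "j \<noteq> l" "j \<noteq> u" by auto
    have "J j \<subseteq> J l \<union> J u"
      using l(1) u(1) j(1) l(2)[OF j(1)] u(2)[OF j(1)] by (auto simp: J_def S_def)
    then have "(\<Union>i\<in>G. J i) = (\<Union>i\<in>G - {j}. J i)"
      using l(1) u(1) j by (auto simp: S_def)
    then have "P (G - {j})" using G by (auto simp: P_def)
    from min[OF this] have "card G \<le> card (G - {j})" .
    moreover have "card (G - {j}) < card G"
      using j(1) fin by (intro card_Diff1_less) (auto simp: S_def)
    ultimately show False by simp
  qed
  with G that show ?thesis by (auto simp: P_def)
qed


text \<open>
  For intervals on which the averages are large the sum of the measures is at most \<open>1/s\<close> times the
  sum of the integrals, and overlap at most two makes the latter at most \<open>2 \<integral> g\<close>.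
\<close>

lemma maxf_finite_weak_type:
  fixes F :: "(real \<times> real) set"
  assumes "sets \<mu> = sets borel" and [measurable]: "g \<in> borel_measurable borel" and "finite F"
    and F: "\<And>a b. (a, b) \<in> F \<Longrightarrow> s * emeasure \<mu> {a<..<b} \<le> (\<integral>\<^sup>+ y \<in> {a<..<b}. g y \<partial>\<mu>)"
  shows "s * emeasure \<mu> (\<Union>(a, b)\<in>F. {a<..<b}) \<le> 2 * (\<integral>\<^sup>+ y. g y \<partial>\<mu>)"
proof -
  note [measurable_cong] = assms(1)
  obtain F' where F': "F' \<subseteq> F" "(\<Union>i\<in>F'. {fst i<..<snd i}) = (\<Union>i\<in>F. {fst i<..<snd i})"
    "\<And>x. card {i \<in> F'. x \<in> {fst i<..<snd i}} \<le> 2"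
    using interval_cover_overlap_2[OF \<open>finite F\<close>] by blast
  have fin: "finite F'" using F' \<open>finite F\<close> finite_subset by auto
  have "s * emeasure \<mu> (\<Union>(a, b)\<in>F. {a<..<b}) = s * emeasure \<mu> (\<Union>i\<in>F'. {fst i<..<snd i})"
    by (simp add: F'(2) split_beta)
  also have "\<dots> \<le> s * (\<Sum>i\<in>F'. emeasure \<mu> {fst i<..<snd i})"
    by (intro mult_left_mono emeasure_subadditive_finite fin) (auto simp: assms(1))
  also have "\<dots> \<le> (\<Sum>i\<in>F'. (\<integral>\<^sup>+ y \<in> {fst i<..<snd i}. g y \<partial>\<mu>))"
    unfolding sum_distrib_left using F'(1) F by (intro sum_mono) auto
  also have "\<dots> = (\<integral>\<^sup>+ y. (\<Sum>i\<in>F'. g y * indicator {fst i<..<snd i} y) \<partial>\<mu>)"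
    by (subst nn_integral_sum) auto
  also have "\<dots> \<le> (\<integral>\<^sup>+ y. 2 * g y \<partial>\<mu>)"
  proof (rule nn_integral_mono)
    fix y
    have "(\<Sum>i\<in>F'. g y * indicator {fst i<..<snd i} y) = g y * of_nat (card {i\<in>F'. y \<in> {fst i<..<snd i}})"
      unfolding sum_distrib_left[symmetric] using fin
      by (simp add: indicator_def of_bool_def sum.If_cases Int_def)
    also have "\<dots> \<le> g y * of_nat 2"
      by (intro mult_left_mono) (use F'(3) of_nat_mono in blast, simp)
    finally show "(\<Sum>i\<in>F'. g y * indicator {fst i<..<snd i} y) \<le> 2 * g y"
      by (simp add: ac_simps)
  qed
  also have "\<dots> = 2 * (\<integral>\<^sup>+ y. g y \<partial>\<mu>)"
    by (rule nn_integral_cmult) auto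
  finally show ?thesis .
qed

lemma maxf_weak_type:
  assumes "sets \<mu> = sets borel" and [measurable]: "g \<in> borel_measurable borel"
  shows "s * emeasure \<mu> {x. s < maxf \<mu> g x} \<le> 2 * (\<integral>\<^sup>+ y. g y \<partial>\<mu>)"
proof -
  note [measurable_cong] = assms(1)
  define E where "E = {(a, b) \<in> \<rat> \<times> \<rat>. s < (\<integral>\<^sup>+ y \<in> {a<..<b}. g y \<partial>\<mu>) / emeasure \<mu> {a<..<b}}"
  have level: "{x. s < maxf \<mu> g x} = (\<Union>(a, b)\<in>E. {a<..<b})"
    unfolding E_def less_maxf_iff by blast
  have E: "s * emeasure \<mu> {a<..<b} \<le> (\<integral>\<^sup>+ y \<in> {a<..<b}. g y \<partial>\<mu>)" if "(a, b) \<in> E" for a b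
  proof -
    define m where "m = emeasure \<mu> {a<..<b}"
    define v where "v = (\<integral>\<^sup>+ y \<in> {a<..<b}. g y \<partial>\<mu>)"
    have *: "s < v / m" using that by (auto simp: E_def m_def v_def)
    show ?thesis
    proof (cases "m = 0 \<or> m = top")
      case True
      then show ?thesis using * by (auto simp: m_def)
    next
      case False
      have "s * m \<le> v / m * m" using * by (intro mult_right_mono) auto
      also have "\<dots> = v" using False by (simp add: ennreal_divide_times ennreal_divide_self less_top)
      finally show ?thesis by (simp add: m_def v_def)
    qed
  qed
  show ?thesis
  proof (cases "E = {}")
    case True
    then show ?thesis by (simp add: level)
  next
    case False
    have "countable E" unfolding E_def
      by (rule countable_subset[of _ "\<rat> \<times> \<rat>"]) (auto simp: countable_rat)
    \<comment> \<open>The finite case applies to the first \<open>n\<close> intervals of an enumeration; let \<open>n \<rightarrow> \<infinity>\<close>.\<close>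
    define e where "e = from_nat_into E"
    have e: "range e = E" using False \<open>countable E\<close> by (simp add: e_def range_from_nat_into)
    define U where "U = (\<lambda>n. \<Union>(a, b)\<in>e ` {..<n}. {a<..<b})"
    have "(\<Union>(a, b)\<in>E. {a<..<b}) = (\<Union>n. U n)"
    proof
      show "(\<Union>(a, b)\<in>E. {a<..<b}) \<subseteq> (\<Union>n. U n)"
      proof
        fix x assume "x \<in> (\<Union>(a, b)\<in>E. {a<..<b})"
        then obtain i where i: "i \<in> E" "x \<in> (case i of (a, b) \<Rightarrow> {a<..<b})"
          by (rule UN_E)
        then obtain n where "i = e n" using e by blast
        with i have "x \<in> U (Suc n)" unfolding U_def by blast
        then show "x \<in> (\<Union>n. U n)" by blast
      qed
      show "(\<Union>n. U n) \<subseteq> (\<Union>(a, b)\<in>E. {a<..<b})"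
        unfolding U_def using e by (intro UN_least UN_upper) blast
    qed
    moreover have "incseq U" 
      unfolding U_def incseq_def by (intro allI impI UN_mono image_mono) auto
    moreover have "range U \<subseteq> sets \<mu>" 
      by (auto simp: U_def assms(1) split_beta intro!: sets.finite_UN)
    ultimately have "emeasure \<mu> (\<Union>(a, b)\<in>E. {a<..<b}) = (SUP n. emeasure \<mu> (U n))"
      using SUP_emeasure_incseq by metis
    moreover have "s * emeasure \<mu> (U n) \<le> 2 * (\<integral>\<^sup>+ y. g y \<partial>\<mu>)" for n
      unfolding U_def using e E assms by (intro maxf_finite_weak_type) auto
    ultimately show ?thesis
      unfolding level by (simp add: SUP_mult_left_ennreal SUP_le_iff)
  qed
qed

text \<open>
  Cutting \<open>g\<close> off below height \<open>s/2\<close> lowers its averages by at most \<open>s/2\<close>, so the level set at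
  height \<open>s\<close> is controlled by the large values of \<open>g\<close> alone.
\<close>

lemma maxf_truncated_weak_type:
  assumes "sets \<mu> = sets borel" and [measurable]: "g \<in> borel_measurable borel" and s: "0 < s"
  shows "ennreal s * emeasure \<mu> {x. ennreal s < maxf \<mu> g x}
    \<le> 4 * (\<integral>\<^sup>+ y. g y * indicator {y. ennreal s < 2 * g y} y \<partial>\<mu>)"
proof -
  note [measurable_cong] = assms(1)
  define h where "h = (\<lambda>y. g y * indicator {y. ennreal s < 2 * g y} y)"
  have [measurable]: "h \<in> borel_measurable borel" unfolding h_def by measurable
  have half: "ennreal s = ennreal (s/2) + ennreal (s/2)"
    using s by (simp flip: ennreal_plus)
  have cut: "g y \<le> h y + ennreal (s/2)" for y
  proof (cases "ennreal s < 2 * g y")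
    case False
    show ?thesis
    proof (cases "g y")
      case (real r)
      with False s show ?thesis
        by (auto simp: h_def ennreal_less_iff ennreal_mult[symmetric] simp flip: ennreal_numeral)
    qed (use False in \<open>auto simp: ennreal_mult_top\<close>)
  qed (auto simp: h_def)
  have "maxf \<mu> g x \<le> maxf \<mu> h x + ennreal (s/2)" for x
  proof (rule maxf_leI)
    fix a b :: real assume ab: "a \<in> \<rat>" "b \<in> \<rat>" "x \<in> {a<..<b}"
    let ?m = "emeasure \<mu> {a<..<b}"
    have "(\<integral>\<^sup>+ y \<in> {a<..<b}. g y \<partial>\<mu>) \<le> (\<integral>\<^sup>+ y. h y * indicator {a<..<b} y + ennreal (s/2) * indicator {a<..<b} y \<partial>\<mu>)"
      using cut by (intro nn_integral_mono) (auto simp: indicator_def)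
    also have "\<dots> = (\<integral>\<^sup>+ y \<in> {a<..<b}. h y \<partial>\<mu>) + ennreal (s/2) * ?m"
      by (subst nn_integral_add) (auto simp: nn_integral_cmult_indicator assms(1))
    finally have "(\<integral>\<^sup>+ y \<in> {a<..<b}. g y \<partial>\<mu>) / ?m
        \<le> ((\<integral>\<^sup>+ y \<in> {a<..<b}. h y \<partial>\<mu>) + ennreal (s/2) * ?m) / ?m"
      by (rule divide_right_mono_ennreal)
    also have "\<dots> = (\<integral>\<^sup>+ y \<in> {a<..<b}. h y \<partial>\<mu>) / ?m + ennreal (s/2) * ?m / ?m"
      by (rule add_divide_distrib_ennreal)
    also have "\<dots> \<le> maxf \<mu> h x + ennreal (s/2)"
    proof (intro add_mono average_le_maxf ab)
      show "ennreal (s/2) * ?m / ?m \<le> ennreal (s/2)"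
        by (cases "?m = 0 \<or> ?m = top") (auto simp: ennreal_mult_divide_eq)
    qed
    finally show "(\<integral>\<^sup>+ y \<in> {a<..<b}. g y \<partial>\<mu>) / ?m \<le> maxf \<mu> h x + ennreal (s/2)" .
  qed
  then have "{x. ennreal s < maxf \<mu> g x} \<subseteq> {x. ennreal (s/2) < maxf \<mu> h x}"
    unfolding half using less_le_trans by fastforce
  then have "emeasure \<mu> {x. ennreal s < maxf \<mu> g x} \<le> emeasure \<mu> {x. ennreal (s/2) < maxf \<mu> h x}"
    by (intro emeasure_mono) (auto simp: assms(1))
  then have "ennreal s * emeasure \<mu> {x. ennreal s < maxf \<mu> g x}
    \<le> ennreal s * emeasure \<mu> {x. ennreal (s/2) < maxf \<mu> h x}"
    by (rule mult_left_mono) simp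
  also have "ennreal s * emeasure \<mu> {x. ennreal (s/2) < maxf \<mu> h x}
    = 2 * (ennreal (s/2) * emeasure \<mu> {x. ennreal (s/2) < maxf \<mu> h x})"
  proof -
    have "ennreal s = 2 * ennreal (s/2)"
      using s by (simp flip: ennreal_numeral ennreal_mult)
    then show ?thesis by (simp add: mult.assoc)
  qed
  also have "2 * (ennreal (s/2) * emeasure \<mu> {x. ennreal (s/2) < maxf \<mu> h x}) \<le> 2 * (2 * (\<integral>\<^sup>+ y. h y \<partial>\<mu>))"
    by (intro mult_left_mono maxf_weak_type assms) auto
  finally show ?thesis by (simp add: h_def mult.assoc[symmetric])
qed

text \<open>
  Marcinkiewicz interpolation with the trivial bound on \<open>L\<^sup>\<infinity>\<close>. The constant is the
  same for all \<open>\<mu>\<close>.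
\<close>

theorem maxf_strong_type:
  assumes "sets \<mu> = sets borel" and "sigma_finite_measure \<mu>"
    and [measurable]: "g \<in> borel_measurable borel" and p: "1 < p"
  shows "(\<integral>\<^sup>+ x. epowr (maxf \<mu> g x) p \<partial>\<mu>)
    \<le> ennreal (4 * (p / (p - 1)) * 2 powr (p - 1)) * (\<integral>\<^sup>+ x. epowr (g x) p \<partial>\<mu>)"
proof -
  note [measurable_cong] = assms(1)
  interpret \<mu>: sigma_finite_measure \<mu> by fact
  interpret pair_sigma_finite lborel \<mu> ..
  have "(\<integral>\<^sup>+ x. epowr (maxf \<mu> g x) p \<partial>\<mu>)
    = (\<integral>\<^sup>+ x. (\<integral>\<^sup>+ s. ennreal (p * s powr (p - 1)) * indicator {s. 0 < s \<and> ennreal s < maxf \<mu> g x} s \<partial>lborel) \<partial>\<mu>)"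
    using p by (simp add: epowr_layer_cake)
  also have "\<dots> = (\<integral>\<^sup>+ s. (\<integral>\<^sup>+ x. ennreal (p * s powr (p - 1)) * indicator {s. 0 < s \<and> ennreal s < maxf \<mu> g x} s \<partial>\<mu>) \<partial>lborel)"
    by (rule Fubini') measurable
  also have "\<dots> \<le> (\<integral>\<^sup>+ s. (\<integral>\<^sup>+ x. ennreal (4 * (p / (p - 1))) * g x * (ennreal ((p - 1) * s powr (p - 1 - 1)) *
      indicator {s. 0 < s \<and> ennreal s < 2 * g x} s) \<partial>\<mu>) \<partial>lborel)"
  proof (rule nn_integral_mono)
    fix s :: real
    show "(\<integral>\<^sup>+ x. ennreal (p * s powr (p - 1)) * indicator {s. 0 < s \<and> ennreal s < maxf \<mu> g x} s \<partial>\<mu>)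
      \<le> (\<integral>\<^sup>+ x. ennreal (4 * (p / (p - 1))) * g x * (ennreal ((p - 1) * s powr (p - 1 - 1)) *
          indicator {s. 0 < s \<and> ennreal s < 2 * g x} s) \<partial>\<mu>)"
    proof (cases "0 < s")
      case s: True
      have "(\<integral>\<^sup>+ x. ennreal (p * s powr (p - 1)) * indicator {s. 0 < s \<and> ennreal s < maxf \<mu> g x} s \<partial>\<mu>)
        = (\<integral>\<^sup>+ x. ennreal (p * s powr (p - 1)) * indicator {x. ennreal s < maxf \<mu> g x} x \<partial>\<mu>)"
        using s by (intro nn_integral_cong) (auto simp: indicator_def)
      also have "\<dots> = ennreal (p * s powr (p - 1)) * emeasure \<mu> {x. ennreal s < maxf \<mu> g x}"
        by (subst nn_integral_cmult_indicator) (auto simp: assms(1))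
      also have "\<dots> = ennreal (p * s powr (p - 2)) * (ennreal s * emeasure \<mu> {x. ennreal s < maxf \<mu> g x})"
      proof -
        have "s powr (p - 1) = s powr (p - 2) * s"
          using s powr_add[of s "p - 2" 1] by simp
        then have "ennreal (p * s powr (p - 1)) = ennreal (p * s powr (p - 2)) * ennreal s"
          using s p by (subst ennreal_mult[symmetric]) (auto simp: mult.assoc)
        then show ?thesis by (simp add: mult.assoc)
      qed
      also have "\<dots> \<le> ennreal (p * s powr (p - 2)) * (4 * (\<integral>\<^sup>+ y. g y * indicator {y. ennreal s < 2 * g y} y \<partial>\<mu>))"
        by (intro mult_left_mono maxf_truncated_weak_type assms s) auto
      also have "\<dots> = ennreal (4 * (p / (p - 1)) * ((p - 1) * s powr (p - 2))) * (\<integral>\<^sup>+ y. g y * indicator {y. ennreal s < 2 * g y} y \<partial>\<mu>)"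
      proof -
        have "ennreal (4 * (p / (p - 1)) * ((p - 1) * s powr (p - 2))) = ennreal (p * s powr (p - 2) * 4)"
          using p by (intro arg_cong[where f = ennreal]) simp
        also have "\<dots> = ennreal (p * s powr (p - 2)) * 4"
          using p by (subst ennreal_mult) auto
        finally show ?thesis by (simp add: mult.assoc)
      qed
      also have "\<dots> = (\<integral>\<^sup>+ y. ennreal (4 * (p / (p - 1)) * ((p - 1) * s powr (p - 2))) * (g y * indicator {y. ennreal s < 2 * g y} y) \<partial>\<mu>)"
        by (subst nn_integral_cmult) auto
      also have "\<dots> = (\<integral>\<^sup>+ x. ennreal (4 * (p / (p - 1))) * g x * (ennreal ((p - 1) * s powr (p - 1 - 1)) *
          indicator {s. 0 < s \<and> ennreal s < 2 * g x} s) \<partial>\<mu>)"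
      proof (intro nn_integral_cong)
        fix y
        have "ennreal (4 * (p / (p - 1)) * ((p - 1) * s powr (p - 2)))
          = ennreal (4 * (p / (p - 1))) * ennreal ((p - 1) * s powr (p - 2))"
          using p by (intro ennreal_mult) auto
        then show "ennreal (4 * (p / (p - 1)) * ((p - 1) * s powr (p - 2))) * (g y * indicator {y. ennreal s < 2 * g y} y)
          = ennreal (4 * (p / (p - 1))) * g y * (ennreal ((p - 1) * s powr (p - 1 - 1)) *
          indicator {s. 0 < s \<and> ennreal s < 2 * g y} s)"
          using s by (simp add: indicator_def mult.assoc mult.left_commute[of "g y"])
      qed
      finally show ?thesis by simp
    qed simp
  qed
  also have "\<dots> = (\<integral>\<^sup>+ x. (\<integral>\<^sup>+ s. ennreal (4 * (p / (p - 1))) * g x * (ennreal ((p - 1) * s powr (p - 1 - 1)) *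
      indicator {s. 0 < s \<and> ennreal s < 2 * g x} s) \<partial>lborel) \<partial>\<mu>)"
    by (rule Fubini'[symmetric]) measurable
  also have "\<dots> = (\<integral>\<^sup>+ x. ennreal (4 * (p / (p - 1))) * g x * epowr (2 * g x) (p - 1) \<partial>\<mu>)"
    using p by (subst nn_integral_cmult) (auto simp: epowr_layer_cake[of "p - 1"])
  also have "\<dots> = (\<integral>\<^sup>+ x. ennreal (4 * (p / (p - 1)) * 2 powr (p - 1)) * epowr (g x) p \<partial>\<mu>)"
  proof (intro nn_integral_cong)
    fix x
    have "epowr (g x) p = g x * epowr (g x) (p - 1)" using epowr_add[of "g x" 1 "p - 1"] by simp
    moreover have "epowr 2 (p - 1) = ennreal (2 powr (p - 1))" using epowr_ennreal[of 2 "p - 1"] by simp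
    moreover have "ennreal (4 * (p / (p - 1)) * 2 powr (p - 1)) = ennreal (4 * (p / (p - 1))) * ennreal (2 powr (p - 1))"
      using p by (intro ennreal_mult) auto
    ultimately show "ennreal (4 * (p / (p - 1))) * g x * epowr (2 * g x) (p - 1) =
      ennreal (4 * (p / (p - 1)) * 2 powr (p - 1)) * epowr (g x) p"
      by (simp only: epowr_mult mult_ac)
  qed
  also have "\<dots> = ennreal (4 * (p / (p - 1)) * 2 powr (p - 1)) * (\<integral>\<^sup>+ x. epowr (g x) p \<partial>\<mu>)"
    by (rule nn_integral_cmult) measurable
  finally show ?thesis .
qed

section \<open>Muckenhoupt weights in factored form\<close>

lemma conjugate_exponent:
  fixes p :: real
  assumes "1 < p" and "q = p / (p - 1)"
  shows "1 < q" "q / (q - 1) = p" "q - 1 = 1 / (p - 1)" "1 / p + 1 / q = 1" "q / p = 1 / (p - 1)"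
    "0 < p" "0 < q"
  using assms(1) unfolding assms(2) by (auto simp: divide_simps)

lemma inverse_mult_self_ennreal_le_1: "inverse x * x \<le> (1::ennreal)"
  by (cases "x = 0 \<or> x = top")
     (auto simp: ennreal_divide_self less_top divide_ennreal_def[symmetric] mult.commute)

lemma inverse_mult_self_ennreal: "0 < x \<Longrightarrow> x < top \<Longrightarrow> inverse x * x = (1::ennreal)"
  using ennreal_divide_self[of x] by (simp add: divide_ennreal_def mult.commute)

text \<open>
  The \<open>A\<^sub>1\<close> condition is required at every point, which makes averages over an interval comparable to
  each value in it. Infinite values are admitted on a null set, because the \<open>A\<^sub>1\<close> weights constructed
  below are infinite series of maximal functions.
\<close>

definition A1_weight :: "real \<Rightarrow> (real \<Rightarrow> ennreal) \<Rightarrow> bool" where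
  "A1_weight A u \<longleftrightarrow> u \<in> borel_measurable borel \<and> (\<forall>x. 0 < u x) \<and>
     (AE x in lborel. u x < \<infinity>) \<and> (\<forall>x. maxf lborel u x \<le> ennreal A * u x)"

text \<open>
  This is \<open>v u\<^sup>1\<^sup>-\<^sup>p\<close>. By Jones' factorization theorem all \<open>A\<^sub>p\<close> weights have this form with
  \<open>A\<^sub>1\<close> weights \<open>u\<close> and \<open>v\<close>.
\<close>

definition factored_weight :: "real \<Rightarrow> (real \<Rightarrow> ennreal) \<Rightarrow> (real \<Rightarrow> ennreal) \<Rightarrow> real \<Rightarrow> ennreal" where
  "factored_weight p u v x = v x * inverse (epowr (u x) (p - 1))"

lemma measurable_fweight [measurable]:
  assumes [measurable]: "u \<in> borel_measurable borel" "v \<in> borel_measurable borel"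
  shows "factored_weight p u v \<in> borel_measurable borel"
  unfolding factored_weight_def[abs_def] by measurable

lemma A1_weightD:
  assumes "A1_weight A u"
  shows "u \<in> borel_measurable borel" "0 < u x" "AE x in lborel. u x < \<infinity>"
    "maxf lborel u x \<le> ennreal A * u x"
  using assms by (auto simp: A1_weight_def)

lemma A1_weight_one: "A1_weight 1 (\<lambda>_. 1)"
proof -
  have "maxf lborel (\<lambda>_. 1) x \<le> 1" for x
  proof (rule maxf_leI)
    fix a b :: real assume "x \<in> {a<..<b}"
    then show "(\<integral>\<^sup>+ y \<in> {a<..<b}. 1 \<partial>lborel) / emeasure lborel {a<..<b} \<le> 1"
      by (simp add: ennreal_divide_self)
  qed
  then show ?thesis by (auto simp: A1_weight_def)
qed

lemma factored_weight_pos: "0 < v x \<Longrightarrow> u x < top \<Longrightarrow> 0 < factored_weight p u v x"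
  by (auto simp: factored_weight_def ennreal_zero_less_mult_iff ennreal_inverse_positive)

lemma factored_weight_finite: "v x < top \<Longrightarrow> 0 < u x \<Longrightarrow> factored_weight p u v x < top"
  by (auto simp: factored_weight_def ennreal_mult_less_top ennreal_mult_eq_top_iff less_top[symmetric])

text \<open>
  With \<open>w = v u\<^sup>1\<^sup>-\<^sup>p\<close> and \<open>\<sigma> = u v\<^sup>1\<^sup>-\<^sup>q\<close>, \<open>q = p / (p - 1)\<close>, duality of weights reads \<open>w = \<sigma>\<^sup>1\<^sup>-\<^sup>p\<close>. It
  holds because \<open>(1 - p) (1 - q) = 1\<close>.
\<close>

lemma factored_weight_dual_real:
  fixes p r s :: real
  assumes "1 < p" and "0 < r" "0 < s"
  defines "w \<equiv> s * inverse (r powr (p - 1))" and "\<sigma> \<equiv> r * inverse (s powr (p / (p - 1) - 1))"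
  shows "0 < w" "0 < \<sigma>" "\<sigma> powr (p - 1) * w = 1" "inverse \<sigma> powr p * \<sigma> = w"
proof -
  show w: "0 < w" using assms(1-3) by (simp add: w_def)
  show s: "0 < \<sigma>" using assms(1-3) by (simp add: \<sigma>_def)
  have "p / (p - 1) - 1 = 1 / (p - 1)" using assms(1) by (simp add: field_simps)
  then have "\<sigma> powr (p - 1) = r powr (p - 1) * inverse s"
    using assms(1-3) unfolding \<sigma>_def by (simp add: powr_mult inverse_eq_divide powr_divide powr_powr)
  then show *: "\<sigma> powr (p - 1) * w = 1" using assms(1-3) unfolding w_def by (simp add: field_simps)
  have "inverse \<sigma> powr p * \<sigma> = inverse (\<sigma> powr (p - 1))"
    using s powr_add[of \<sigma> "p - 1" 1] by (simp add: inverse_eq_divide powr_divide)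
  also have "\<dots> = w" using * by (metis inverse_unique)
  finally show "inverse \<sigma> powr p * \<sigma> = w" .
qed

lemma factored_weight_dual:
  assumes p: "1 < p" and "0 < u x" "u x < top" "0 < v x" "v x < top"
  shows "epowr (factored_weight (p / (p - 1)) v u x) (p - 1) * factored_weight p u v x = 1"
    and "epowr (inverse (factored_weight (p / (p - 1)) v u x)) p * factored_weight (p / (p - 1)) v u x = factored_weight p u v x"
proof -
  obtain r s where r: "u x = ennreal r" "0 < r" and s: "v x = ennreal s" "0 < s"
    using assms by (metis ennreal_cases ennreal_less_zero_iff less_irrefl)
  note d = factored_weight_dual_real[OF p r(2) s(2)]
  have w: "factored_weight p u v x = ennreal (s * inverse (r powr (p - 1)))"
    using r s by (simp add: factored_weight_def epowr_ennreal inverse_ennreal ennreal_mult)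
  have v: "factored_weight (p / (p - 1)) v u x = ennreal (r * inverse (s powr (p / (p - 1) - 1)))"
    using r s by (simp add: factored_weight_def epowr_ennreal inverse_ennreal ennreal_mult)
  show "epowr (factored_weight (p / (p - 1)) v u x) (p - 1) * factored_weight p u v x = 1"
    unfolding v w using d(1-3) by (simp add: epowr_ennreal flip: ennreal_mult)
  show "epowr (inverse (factored_weight (p / (p - 1)) v u x)) p * factored_weight (p / (p - 1)) v u x = factored_weight p u v x"
    unfolding v w using d(1,2,4) by (simp only: inverse_ennreal epowr_ennreal ennreal_mult[symmetric]
       order_less_imp_le powr_ge_zero inverse_nonnegative_iff_nonnegative)
qed

lemma A1_weight_interval_integral:
  assumes u: "A1_weight A u" and ab: "a \<in> \<rat>" "b \<in> \<rat>" "a < b"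
  shows "0 < (\<integral>\<^sup>+ y \<in> {a<..<b}. u y \<partial>lborel)" "(\<integral>\<^sup>+ y \<in> {a<..<b}. u y \<partial>lborel) < top"
proof -
  note [measurable] = A1_weightD(1)[OF u]
  show "0 < (\<integral>\<^sup>+ y \<in> {a<..<b}. u y \<partial>lborel)"
  proof (rule ccontr)
    assume "\<not> ?thesis"
    then have "AE y in lborel. u y * indicator {a<..<b} y = 0"
      by (subst nn_integral_0_iff_AE[symmetric]) auto
    then have "AE y in lborel. y \<notin> {a<..<b}"
      by eventually_elim (use A1_weightD(2)[OF u] in \<open>auto simp: indicator_def less_le split: if_splits\<close>)
    then have "emeasure lborel {a<..<b} = 0"
      by (subst (asm) AE_iff_measurable[of "{a<..<b}"]) auto
    with ab show False by simp
  qed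
  have "\<exists>x\<in>{a<..<b}. u x < top"
  proof (rule ccontr)
    assume "\<not> ?thesis"
    then have "AE y in lborel. y \<notin> {a<..<b}"
      using A1_weightD(3)[OF u] by (auto elim!: eventually_mono)
    then have "emeasure lborel {a<..<b} = 0"
      by (subst (asm) AE_iff_measurable[of "{a<..<b}"]) auto
    with ab show False by simp
  qed
  then obtain x where x: "x \<in> {a<..<b}" "u x < top" by auto
  have "(\<integral>\<^sup>+ y \<in> {a<..<b}. u y \<partial>lborel) / emeasure lborel {a<..<b} \<le> ennreal A * u x"
    using average_le_maxf[OF ab(1,2) x(1), of lborel u] A1_weightD(4)[OF u, of x] by simp
  also have "\<dots> < top" using x by (simp add: ennreal_mult_less_top)
  finally show "(\<integral>\<^sup>+ y \<in> {a<..<b}. u y \<partial>lborel) < top"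
    using ab by (cases "(\<integral>\<^sup>+ y \<in> {a<..<b}. u y \<partial>lborel) = top") (auto simp: ennreal_top_divide less_top)
qed

text \<open>
  On an interval the \<open>A\<^sub>1\<close> weight \<open>u\<close> is bounded below by its average divided by \<open>A\<close>, so the negative
  power \<open>u\<^sup>1\<^sup>-\<^sup>p\<close> can be replaced by that of the average.
\<close>

lemma factored_weight_interval_integral_le:
  assumes u: "A1_weight A u" and v: "A1_weight A v" and ab: "a \<in> \<rat>" "b \<in> \<rat>" and p: "1 < p"
  shows "(\<integral>\<^sup>+ y \<in> {a<..<b}. factored_weight p u v y \<partial>lborel) *
      epowr ((\<integral>\<^sup>+ y \<in> {a<..<b}. u y \<partial>lborel) / emeasure lborel {a<..<b}) (p - 1)
    \<le> epowr (ennreal A) (p - 1) * (\<integral>\<^sup>+ y \<in> {a<..<b}. v y \<partial>lborel)"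
proof -
  note [measurable] = A1_weightD(1)[OF u] A1_weightD(1)[OF v]
  let ?m = "(\<integral>\<^sup>+ y \<in> {a<..<b}. u y \<partial>lborel) / emeasure lborel {a<..<b}"
  have "factored_weight p u v y * indicator {a<..<b} y * epowr ?m (p - 1)
      \<le> epowr (ennreal A) (p - 1) * (v y * indicator {a<..<b} y)" for y
  proof (cases "y \<in> {a<..<b}")
    case y: True
    have "?m \<le> ennreal A * u y"
      using average_le_maxf[OF ab y, of lborel u] A1_weightD(4)[OF u, of y] by simp
    then have "epowr ?m (p - 1) \<le> epowr (ennreal A) (p - 1) * epowr (u y) (p - 1)"
      using p by (simp add: epowr_mono flip: epowr_mult)
    then have "factored_weight p u v y * epowr ?m (p - 1) \<le> factored_weight p u v y * (epowr (ennreal A) (p - 1) * epowr (u y) (p - 1))"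
      by (rule mult_left_mono) simp
    also have "\<dots> = epowr (ennreal A) (p - 1) * v y * (inverse (epowr (u y) (p - 1)) * epowr (u y) (p - 1))"
      by (simp add: factored_weight_def mult_ac)
    also have "\<dots> \<le> epowr (ennreal A) (p - 1) * v y * 1"
      by (intro mult_left_mono inverse_mult_self_ennreal_le_1) simp
    finally show ?thesis using y by (simp add: mult_ac)
  qed simp
  then have "(\<integral>\<^sup>+ y. factored_weight p u v y * indicator {a<..<b} y * epowr ?m (p - 1) \<partial>lborel)
      \<le> (\<integral>\<^sup>+ y. epowr (ennreal A) (p - 1) * (v y * indicator {a<..<b} y) \<partial>lborel)"
    by (rule nn_integral_mono)
  then show ?thesis by (simp add: nn_integral_multc nn_integral_cmult)
qed

text \<open>
  The easy half of Jones' factorization theorem: multiply the estimate above for \<open>w\<close> and the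
  \<open>(p - 1)\<close>-st power of the one for \<open>\<sigma>\<close>. The averages of \<open>u\<close> and \<open>v\<close> cancel.
\<close>

lemma factored_weight_Ap_condition:
  assumes u: "A1_weight A u" and v: "A1_weight A v" and A: "0 < A"
    and ab: "a \<in> \<rat>" "b \<in> \<rat>" "a < b" and p: "1 < p"
  shows "(\<integral>\<^sup>+ y \<in> {a<..<b}. factored_weight p u v y \<partial>lborel) *
      epowr (\<integral>\<^sup>+ y \<in> {a<..<b}. factored_weight (p / (p - 1)) v u y \<partial>lborel) (p - 1)
    \<le> ennreal (A powr p * (b - a) powr p)"
proof -
  define W where "W = (\<integral>\<^sup>+ y \<in> {a<..<b}. factored_weight p u v y \<partial>lborel)"
  define S where "S = (\<integral>\<^sup>+ y \<in> {a<..<b}. factored_weight (p / (p - 1)) v u y \<partial>lborel)"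
  define U where "U = (\<integral>\<^sup>+ y \<in> {a<..<b}. u y \<partial>lborel)"
  define V where "V = (\<integral>\<^sup>+ y \<in> {a<..<b}. v y \<partial>lborel)"
  define m where "m = ennreal (b - a)"
  define q where "q = p / (p - 1)"
  note q = conjugate_exponent[OF p q_def]
  have m: "emeasure lborel {a<..<b} = m" "0 < m" "m < top" using ab by (auto simp: m_def)
  have U: "0 < U" "U < top" and V: "0 < V" "V < top"
    using A1_weight_interval_integral[OF u ab] A1_weight_interval_integral[OF v ab]
    by (auto simp: U_def V_def)
  have 1: "W * epowr (U / m) (p - 1) \<le> epowr (ennreal A) (p - 1) * V"
    using factored_weight_interval_integral_le[OF u v ab(1,2) p] m by (simp add: W_def U_def V_def)
  have "S * epowr (V / m) (q - 1) \<le> epowr (ennreal A) (q - 1) * U"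
    using factored_weight_interval_integral_le[OF v u ab(1,2) q(1)] m by (simp add: S_def U_def V_def q_def)
  then have "epowr (S * epowr (V / m) (q - 1)) (p - 1) \<le> epowr (epowr (ennreal A) (q - 1) * U) (p - 1)"
    using p by (intro epowr_mono) auto
  then have 2: "epowr S (p - 1) * (V / m) \<le> ennreal A * epowr U (p - 1)"
    using p q(3) by (simp add: epowr_mult epowr_epowr)
  \<comment> \<open>the factor containing the averages, to be cancelled at the end\<close>
  define Q where "Q = epowr U (p - 1) * V"
  have Q: "Q \<noteq> 0" "Q \<noteq> top" using U V by (auto simp: Q_def ennreal_mult_eq_top_iff)
  have mp: "epowr m p = epowr m (p - 1) * m" using epowr_add[of m "p - 1" 1] by simp
  have canc: "U / m * m = U" "V / m * m = V"
    using m by (auto simp: ennreal_divide_times ennreal_divide_self)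
  have "Q = epowr (U / m * m) (p - 1) * (V / m * m)" unfolding canc Q_def ..
  also have "\<dots> = epowr (U / m) (p - 1) * (V / m) * epowr m p"
    unfolding mp epowr_mult by (simp only: mult_ac)
  finally have Qm: "Q = epowr (U / m) (p - 1) * (V / m) * epowr m p" .
  have "Q * (W * epowr S (p - 1))
      = (W * epowr (U / m) (p - 1)) * (epowr S (p - 1) * (V / m)) * epowr m p"
    unfolding Qm by (simp only: mult_ac)
  also have "\<dots> \<le> (epowr (ennreal A) (p - 1) * V) * (ennreal A * epowr U (p - 1)) * epowr m p"
    by (intro mult_mono 1 2) auto
  also have "\<dots> = Q * (epowr (ennreal A) (p - 1) * epowr (ennreal A) 1 * epowr m p)"
    unfolding Q_def by (simp only: mult_ac epowr_one)
  also have "\<dots> = Q * ennreal (A powr p * (b - a) powr p)"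
    unfolding epowr_add[symmetric] using A ab by (simp add: m_def epowr_ennreal ennreal_mult)
  finally show ?thesis
    using Q by (simp add: ennreal_mult_le_mult_iff W_def S_def)
qed


section \<open>Muckenhoupt's theorem\<close>

text \<open>
  Lerner's argument. Up to normalization, an average of \<open>f\<close> over \<open>I\<close> is one of \<open>f / \<sigma>\<close> with respect to
  \<open>\<sigma> dx\<close>, which is at most its maximal function anywhere on \<open>I\<close>. Raised to the power \<open>p - 1\<close>
  this is averaged over \<open>I\<close> with respect to \<open>dx\<close>, i.e. after division by \<open>w\<close> with respect to
  \<open>w dx\<close>. The \<open>A\<^sub>p\<close> condition is what relates the four normalizing factors.
\<close>

lemma maxf_le_iterated_weighted_maxf:
  assumes u: "A1_weight A u" and v: "A1_weight A v" and A: "0 < A" and p: "1 < p"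
    and [measurable]: "f \<in> borel_measurable borel"
  defines "w \<equiv> factored_weight p u v" and "\<sigma> \<equiv> factored_weight (p / (p - 1)) v u"
  shows "epowr (maxf lborel f x) (p - 1) \<le> ennreal (A powr p) *
    maxf (density lborel w) (\<lambda>y. epowr (maxf (density lborel \<sigma>) (\<lambda>z. f z * inverse (\<sigma> z)) y) (p - 1)
      * inverse (w y)) x" (is "_ \<le> _ * maxf _ ?\<Phi> x")
proof -
  note [measurable] = A1_weightD(1)[OF u] A1_weightD(1)[OF v]
  have [measurable]: "w \<in> borel_measurable borel" "\<sigma> \<in> borel_measurable borel"
    unfolding w_def \<sigma>_def by measurable
  have ae: "AE y in lborel. 0 < w y \<and> w y < top \<and> 0 < \<sigma> y \<and> \<sigma> y < top"
    using A1_weightD(3)[OF u] A1_weightD(3)[OF v]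
    by eventually_elim
      (use A1_weightD(2)[OF u] A1_weightD(2)[OF v] in \<open>auto simp: w_def \<sigma>_def intro!: factored_weight_pos factored_weight_finite\<close>)
  have "maxf lborel f x \<le> epowr (ennreal (A powr p) * maxf (density lborel w) ?\<Phi> x) (1 / (p - 1))"
  proof (rule maxf_leI)
    fix a b :: real assume ab: "a \<in> \<rat>" "b \<in> \<rat>" and x: "x \<in> {a<..<b}"
    then have ab': "a < b" by simp
    let ?I = "{a<..<b}"
    define F where "F = (\<integral>\<^sup>+ y \<in> ?I. f y \<partial>lborel)"
    define W where "W = (\<integral>\<^sup>+ y \<in> ?I. w y \<partial>lborel)"
    define S where "S = (\<integral>\<^sup>+ y \<in> ?I. \<sigma> y \<partial>lborel)"
    have pos: "0 < (\<integral>\<^sup>+ y \<in> ?I. h y \<partial>lborel)"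
      if [measurable]: "h \<in> borel_measurable borel" and h: "AE y in lborel. 0 < h y" for h :: "real \<Rightarrow> ennreal"
    proof (rule ccontr)
      assume "\<not> ?thesis"
      then have "AE y in lborel. h y * indicator ?I y = 0"
        by (subst nn_integral_0_iff_AE[symmetric]) auto
      then have "AE y in lborel. y \<notin> ?I"
        using h by eventually_elim (auto simp: indicator_def split: if_splits)
      then have "emeasure lborel ?I = 0"
        by (subst (asm) AE_iff_measurable[of "?I"]) auto
      with ab' show False by simp
    qed
    have W0: "0 < W" and S0: "0 < S"
      unfolding W_def S_def using ae by (auto intro!: pos elim!: eventually_mono)
    have Ap: "W * epowr S (p - 1) \<le> ennreal (A powr p * (b - a) powr p)"
      using factored_weight_Ap_condition[OF u v A ab ab' p] by (simp add: W_def S_def w_def \<sigma>_def)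
    then have "W * epowr S (p - 1) < top" by (rule le_less_trans) simp
    then have fin: "W < top" "S < top"
      using W0 S0 by (auto simp: ennreal_mult_less_top)
    have mw: "emeasure (density lborel w) ?I = W" "emeasure (density lborel \<sigma>) ?I = S"
      by (auto simp: emeasure_density W_def S_def)
    have "(\<integral>\<^sup>+ z \<in> ?I. f z * inverse (\<sigma> z) \<partial>density lborel \<sigma>) = (\<integral>\<^sup>+ z. \<sigma> z * (f z * inverse (\<sigma> z) * indicator ?I z) \<partial>lborel)"
      by (rule nn_integral_density) auto
    also have "\<dots> = F"
      unfolding F_def
    proof (rule nn_integral_cong_AE)
      show "AE z in lborel. \<sigma> z * (f z * inverse (\<sigma> z) * indicator ?I z) = f z * indicator ?I z"
        using ae
      proof eventually_elim
        case (elim z)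
        have "\<sigma> z * (f z * inverse (\<sigma> z) * indicator ?I z) = inverse (\<sigma> z) * \<sigma> z * (f z * indicator ?I z)"
          by (simp only: mult_ac)
        with elim show ?case by (simp add: inverse_mult_self_ennreal)
      qed
    qed
    finally have avg: "F / S \<le> maxf (density lborel \<sigma>) (\<lambda>z. f z * inverse (\<sigma> z)) y" if "y \<in> ?I" for y
      using average_le_maxf[OF ab that, of "density lborel \<sigma>" "\<lambda>z. f z * inverse (\<sigma> z)"] mw by simp
    have "epowr (F / S) (p - 1) * ennreal (b - a) = (\<integral>\<^sup>+ y. epowr (F / S) (p - 1) * indicator ?I y \<partial>lborel)"
      using ab' by (subst nn_integral_cmult_indicator) auto
    also have "\<dots> \<le> (\<integral>\<^sup>+ y. w y * (?\<Phi> y * indicator ?I y) \<partial>lborel)"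
    proof (rule nn_integral_mono_AE)
      show "AE y in lborel. epowr (F / S) (p - 1) * indicator ?I y \<le> w y * (?\<Phi> y * indicator ?I y)"
        using ae
      proof eventually_elim
        case (elim y)
        have "w y * (?\<Phi> y * indicator ?I y) = inverse (w y) * w y *
            (epowr (maxf (density lborel \<sigma>) (\<lambda>z. f z * inverse (\<sigma> z)) y) (p - 1) * indicator ?I y)"
          by (simp only: mult_ac)
        with elim avg[of y] p show ?case
          by (auto simp: inverse_mult_self_ennreal indicator_def intro!: epowr_mono)
      qed
    qed
    also have "\<dots> = (\<integral>\<^sup>+ y \<in> ?I. ?\<Phi> y \<partial>density lborel w)"
      by (rule nn_integral_density[symmetric]) auto
    finally have "epowr (F / S) (p - 1) * ennreal (b - a) / W \<le> (\<integral>\<^sup>+ y \<in> ?I. ?\<Phi> y \<partial>density lborel w) / W"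
      by (rule divide_right_mono_ennreal)
    also have "\<dots> \<le> maxf (density lborel w) ?\<Phi> x"
      using average_le_maxf[OF ab x, of "density lborel w" ?\<Phi>] mw by simp
    finally have low: "epowr (F / S) (p - 1) * ennreal (b - a) / W \<le> maxf (density lborel w) ?\<Phi> x" .
    obtain W' S' where W': "W = ennreal W'" "0 < W'" and S': "S = ennreal S'" "0 < S'"
      using W0 S0 fin by (metis ennreal_cases ennreal_less_zero_iff less_irrefl)
    have "ennreal (W' * S' powr (p - 1)) \<le> ennreal (A powr p * (b - a) powr p)"
      using Ap W' S' by (simp add: epowr_ennreal ennreal_mult)
    then have "W' * S' powr (p - 1) \<le> A powr p * (b - a) powr p"
      by (subst (asm) ennreal_le_iff) auto
    moreover have "(b - a) powr p = (b - a) powr (p - 1) * (b - a)"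
      using ab' powr_add[of "b - a" "p - 1" 1] by simp
    ultimately have le: "inverse ((b - a) powr (p - 1)) \<le> A powr p * (inverse (S' powr (p - 1)) * ((b - a) * inverse W'))"
      using W' S' ab' by (simp add: field_simps)
    have inverse_powr: "inverse r powr (p - 1) = inverse (r powr (p - 1))" if "0 < r" for r :: real
      using that by (simp add: powr_def ln_inverse exp_minus)
    have "epowr (F / emeasure lborel ?I) (p - 1) = epowr F (p - 1) * ennreal (inverse ((b - a) powr (p - 1)))"
      using ab' by (simp add: divide_ennreal_def epowr_mult epowr_ennreal inverse_ennreal inverse_powr)
    also have "\<dots> \<le> epowr F (p - 1) * ennreal (A powr p * (inverse (S' powr (p - 1)) * ((b - a) * inverse W')))"
      by (intro mult_left_mono ennreal_leI le) simp
    also have "ennreal (A powr p * (inverse (S' powr (p - 1)) * ((b - a) * inverse W')))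
      = ennreal (A powr p) * (ennreal (inverse (S' powr (p - 1))) * (ennreal (b - a) * ennreal (inverse W')))"
      using ab' W' S' by (subst ennreal_mult, simp, simp, subst ennreal_mult, simp, simp, subst ennreal_mult) auto
    also have "epowr F (p - 1) * \<dots> = ennreal (A powr p) * (epowr (F / S) (p - 1) * ennreal (b - a) / W)"
      using W' S' by (simp add: divide_ennreal_def epowr_mult epowr_ennreal inverse_ennreal inverse_powr mult_ac)
    also have "\<dots> \<le> ennreal (A powr p) * maxf (density lborel w) ?\<Phi> x"
      by (intro mult_left_mono low) simp
    finally show "F / emeasure lborel ?I \<le> epowr (ennreal (A powr p) * maxf (density lborel w) ?\<Phi> x) (1 / (p - 1))"
      using p by (simp add: epowr_le_iff)
  qed
  then show ?thesis using p by (subst epowr_le_iff) auto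
qed

text \<open>
  The constant may depend only on the \<open>A\<^sub>1\<close> constants of the two factors, not on the pair of functions:
  this uniformity is what allows the inequality to be integrated over further parameters. Stating it
  for a set of pairs rather than for an operator makes it applicable to norms of functions.
\<close>

definition weighted_bound :: "real \<Rightarrow> ((real \<Rightarrow> ennreal) \<times> (real \<Rightarrow> ennreal)) set \<Rightarrow> bool" where
  "weighted_bound p \<F> \<longleftrightarrow> (\<forall>A>0. \<exists>N::real. \<forall>u v. A1_weight A u \<longrightarrow> A1_weight A v \<longrightarrow>
     (\<forall>(g, f) \<in> \<F>. (\<integral>\<^sup>+ x. epowr (g x) p * factored_weight p u v x \<partial>lborel)
        \<le> ennreal N * (\<integral>\<^sup>+ x. epowr (f x) p * factored_weight p u v x \<partial>lborel)))"

text \<open>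
  By the pointwise bound it remains to use the \<open>L\<^sup>q(w dx)\<close> bound for the outer and the \<open>L\<^sup>p(\<sigma> dx)\<close>
  bound for the inner maximal function. The powers of the weights match by duality: \<open>w\<^sup>1\<^sup>-\<^sup>q = \<sigma>\<close> after the
  outer and \<open>\<sigma>\<^sup>1\<^sup>-\<^sup>p = w\<close> after the inner one.
\<close>

theorem muckenhoupt:
  assumes p: "1 < p"
  shows "weighted_bound p {(maxf lborel f, f) | f. f \<in> borel_measurable borel}"
  unfolding weighted_bound_def
proof (intro allI impI)
  fix A :: real assume A: "0 < A"
  define q where "q = p / (p - 1)"
  note q = conjugate_exponent[OF p q_def]
  define D where "D = (\<lambda>p. 4 * (p / (p - 1)) * 2 powr (p - 1) :: real)"
  show "\<exists>N::real. \<forall>u v. A1_weight A u \<longrightarrow> A1_weight A v \<longrightarrow>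
     (\<forall>(g, f) \<in> {(maxf lborel f, f) | f. f \<in> borel_measurable borel}.
        (\<integral>\<^sup>+ x. epowr (g x) p * factored_weight p u v x \<partial>lborel)
        \<le> ennreal N * (\<integral>\<^sup>+ x. epowr (f x) p * factored_weight p u v x \<partial>lborel))"
  proof (intro exI allI impI ballI, clarify)
    fix u v f :: "real \<Rightarrow> ennreal"
    assume u: "A1_weight A u" and v: "A1_weight A v" and [measurable]: "f \<in> borel_measurable borel"
    note [measurable] = A1_weightD(1)[OF u] A1_weightD(1)[OF v]
    define w where "w = factored_weight p u v"
    define \<sigma> where "\<sigma> = factored_weight q v u"
    have [measurable]: "w \<in> borel_measurable borel" "\<sigma> \<in> borel_measurable borel"
      unfolding w_def \<sigma>_def by measurable
    have dual_p: "epowr (inverse (\<sigma> y)) p * \<sigma> y = w y" 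
      and dual_q: "epowr (inverse (w y)) q * w y = \<sigma> y" and fin: "w y < top" "\<sigma> y < top"
      and pos: "0 < w y"
      if "u y < top" "v y < top" for y
      using that A1_weightD(2)[OF u, of y] A1_weightD(2)[OF v, of y]
        factored_weight_dual(2)[of p u y v] factored_weight_dual(2)[of q v y u] p q
      by (auto simp: w_def \<sigma>_def q_def[symmetric] intro: factored_weight_finite factored_weight_pos)
    have "AE y in lborel. w y \<noteq> \<infinity>" "AE y in lborel. \<sigma> y \<noteq> \<infinity>"
      using A1_weightD(3)[OF u] A1_weightD(3)[OF v] by (eventually_elim, use fin in force)+
    then have sf: "sigma_finite_measure (density lborel w)" "sigma_finite_measure (density lborel \<sigma>)"
      by (auto simp: sigma_finite_measure.sigma_finite_iff_density_finite[OF sigma_finite_lborel])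
    define m where "m = maxf (density lborel \<sigma>) (\<lambda>z. f z * inverse (\<sigma> z))"
    define \<Phi> where "\<Phi> = (\<lambda>y. epowr (m y) (p - 1) * inverse (w y))"
    have [measurable]: "m \<in> borel_measurable borel" "\<Phi> \<in> borel_measurable borel"
      unfolding m_def \<Phi>_def by measurable
    have pt: "epowr (maxf lborel f x) p \<le> ennreal ((A powr p) powr q) * epowr (maxf (density lborel w) \<Phi> x) q" for x
    proof -
      have "epowr (maxf lborel f x) p = epowr (epowr (maxf lborel f x) (p - 1)) q"
        using p by (simp add: epowr_epowr q_def)
      also have "\<dots> \<le> epowr (ennreal (A powr p) * maxf (density lborel w) \<Phi> x) q"
        using maxf_le_iterated_weighted_maxf[OF u v A p, of f x] q
        by (intro epowr_mono) (auto simp: w_def \<sigma>_def \<Phi>_def m_def q_def)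
      finally show ?thesis by (simp add: epowr_mult epowr_ennreal)
    qed
    have "(\<integral>\<^sup>+ x. epowr (maxf lborel f x) p * w x \<partial>lborel)
      \<le> (\<integral>\<^sup>+ x. ennreal ((A powr p) powr q) * (w x * epowr (maxf (density lborel w) \<Phi> x) q) \<partial>lborel)"
      using mult_right_mono[OF pt] by (intro nn_integral_mono) (simp add: mult_ac)
    also have "\<dots> = ennreal ((A powr p) powr q) * (\<integral>\<^sup>+ x. epowr (maxf (density lborel w) \<Phi> x) q \<partial>density lborel w)"
      by (subst nn_integral_cmult) (auto simp: nn_integral_density)
    also have "\<dots> \<le> ennreal ((A powr p) powr q) * (ennreal (D q) * (\<integral>\<^sup>+ x. epowr (\<Phi> x) q \<partial>density lborel w))"
      unfolding D_def using sf q(1) by (intro mult_left_mono maxf_strong_type) auto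
    also have "(\<integral>\<^sup>+ x. epowr (\<Phi> x) q \<partial>density lborel w) = (\<integral>\<^sup>+ x. epowr (m x) p \<partial>density lborel \<sigma>)"
    proof -
      have "AE x in lborel. w x * epowr (\<Phi> x) q = \<sigma> x * epowr (m x) p"
        using A1_weightD(3)[OF u] A1_weightD(3)[OF v]
      proof eventually_elim
        case (elim x)
        have "w x * epowr (\<Phi> x) q = epowr (epowr (m x) (p - 1)) q * (epowr (inverse (w x)) q * w x)"
          unfolding \<Phi>_def by (simp add: epowr_mult mult_ac)
        also have "\<dots> = epowr (m x) p * \<sigma> x"
          using elim p by (subst dual_q) (auto simp: epowr_epowr q_def)
        finally show ?case by (simp add: mult_ac)
      qed
      then show ?thesis by (auto simp: nn_integral_density intro!: nn_integral_cong_AE)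
    qed
    also have "\<dots> \<le> ennreal (D p) * (\<integral>\<^sup>+ x. epowr (f x * inverse (\<sigma> x)) p \<partial>density lborel \<sigma>)"
      unfolding D_def m_def using sf p by (intro maxf_strong_type) auto
    also have "(\<integral>\<^sup>+ x. epowr (f x * inverse (\<sigma> x)) p \<partial>density lborel \<sigma>) = (\<integral>\<^sup>+ x. epowr (f x) p * w x \<partial>lborel)"
    proof -
      have "AE x in lborel. \<sigma> x * epowr (f x * inverse (\<sigma> x)) p = epowr (f x) p * w x"
        using A1_weightD(3)[OF u] A1_weightD(3)[OF v]
        by eventually_elim (simp add: epowr_mult mult_ac flip: dual_p)
      then show ?thesis by (auto simp: nn_integral_density intro!: nn_integral_cong_AE)
    qed
    finally have "(\<integral>\<^sup>+ x. epowr (maxf lborel f x) p * w x \<partial>lborel)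
      \<le> ennreal ((A powr p) powr q) * (ennreal (D q) * (ennreal (D p) * (\<integral>\<^sup>+ x. epowr (f x) p * w x \<partial>lborel)))"
      by (simp add: mult_left_mono)
    also have "\<dots> = ennreal ((A powr p) powr q * D q * D p) * (\<integral>\<^sup>+ x. epowr (f x) p * w x \<partial>lborel)"
    proof -
      have "0 \<le> D p" "0 \<le> D q" using p q by (auto simp: D_def)
      then show ?thesis by (simp add: ennreal_mult mult.assoc)
    qed
    finally show "(\<integral>\<^sup>+ x. epowr (maxf lborel f x) p * factored_weight p u v x \<partial>lborel)
      \<le> ennreal ((A powr p) powr q * D q * D p) * (\<integral>\<^sup>+ x. epowr (f x) p * factored_weight p u v x \<partial>lborel)"
      by (simp add: w_def)
  qed
qed

section \<open>Rubio de Francia extrapolation\<close>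

text \<open>
  The Rubio de Francia algorithm: when \<open>c\<close> bounds the norm of the maximal operator on some \<open>L\<^sup>p(W)\<close>,
  the series of its normalized iterates majorizes \<open>f\<close>, has comparable norm, and is an \<open>A\<^sub>1\<close> weight,
  since applying the maximal operator only shifts the series by one term. The factor \<open>4\<close> instead of the
  customary \<open>2\<close> leaves a geometric factor to spare, by which the norm of the sum is estimated without
  Minkowski's inequality.
\<close>

definition rdf_majorant :: "real \<Rightarrow> (real \<Rightarrow> ennreal) \<Rightarrow> real \<Rightarrow> ennreal" where
  "rdf_majorant c f x = (\<Sum>k. ennreal (inverse (4 * c) ^ k) * (maxf lborel ^^ k) f x)"

lemma measurable_maxf_iterate [measurable]:
  "f \<in> borel_measurable borel \<Longrightarrow> (maxf lborel ^^ k) f \<in> borel_measurable borel"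
  by (cases k) auto

lemma measurable_rdf_majorant [measurable]:
  assumes [measurable]: "f \<in> borel_measurable borel"
  shows "rdf_majorant c f \<in> borel_measurable borel"
  unfolding rdf_majorant_def[abs_def] by measurable

lemma le_rdf_majorant: "f x \<le> rdf_majorant c f x"
proof -
  have "f x = (\<Sum>k<1. ennreal (inverse (4 * c) ^ k) * (maxf lborel ^^ k) f x)" by simp
  also have "\<dots> \<le> rdf_majorant c f x"
    unfolding rdf_majorant_def by (rule sum_le_suminf) auto
  finally show ?thesis .
qed

lemma maxf_rdf_majorant_le:
  assumes c: "0 < c" and [measurable]: "f \<in> borel_measurable borel"
  shows "maxf lborel (rdf_majorant c f) x \<le> ennreal (4 * c) * rdf_majorant c f x"
proof -
  let ?t = "\<lambda>k. ennreal (4 * c) * (ennreal (inverse (4 * c) ^ k) * (maxf lborel ^^ k) f x)"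
  have "maxf lborel (rdf_majorant c f) x
      \<le> (\<Sum>k. maxf lborel (\<lambda>y. ennreal (inverse (4 * c) ^ k) * (maxf lborel ^^ k) f y) x)"
    unfolding rdf_majorant_def[abs_def] by (intro maxf_suminf_le) auto
  also have "\<dots> = (\<Sum>k. ?t (Suc k))"
  proof (intro suminf_cong)
    fix k
    have "ennreal (4 * c) * ennreal (inverse (4 * c) ^ Suc k) = ennreal (inverse (4 * c) ^ k)"
      using c by (subst ennreal_mult[symmetric]) (auto simp: field_simps)
    then show "maxf lborel (\<lambda>y. ennreal (inverse (4 * c) ^ k) * (maxf lborel ^^ k) f y) x = ?t (Suc k)"
      by (subst maxf_cmult) (auto simp: mult.assoc[symmetric])
  qed
  also have "\<dots> \<le> (\<Sum>k. ?t (k + 1)) + (\<Sum>k<1. ?t k)"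
    by simp
  also have "\<dots> = (\<Sum>k. ?t k)"
    by (rule suminf_offset[symmetric]) (rule summableI)
  also have "\<dots> = ennreal (4 * c) * rdf_majorant c f x"
    unfolding rdf_majorant_def by (rule ennreal_suminf_cmult)
  finally show ?thesis .
qed

text \<open>
  Writing \<open>4\<^sup>-\<^sup>k = 2\<^sup>-\<^sup>k 2\<^sup>-\<^sup>k\<close>, the series is at most twice the supremum of the terms with coefficients
  \<open>(2 c)\<^sup>-\<^sup>k\<close>, and the \<open>p\<close>-th power of a supremum is at most the sum of the \<open>p\<close>-th powers.
\<close>

lemma rdf_majorant_norm_le:
  assumes c: "1 \<le> c" and p: "1 \<le> p" and [measurable]: "W \<in> borel_measurable borel"
    and M: "\<And>f. f \<in> borel_measurable borel \<Longrightarrow>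
      (\<integral>\<^sup>+ x. epowr (maxf lborel f x) p * W x \<partial>lborel) \<le> ennreal (c powr p) * (\<integral>\<^sup>+ x. epowr (f x) p * W x \<partial>lborel)"
    and [measurable]: "f \<in> borel_measurable borel"
  shows "(\<integral>\<^sup>+ x. epowr (rdf_majorant c f x) p * W x \<partial>lborel)
    \<le> ennreal (2 powr (p + 1)) * (\<integral>\<^sup>+ x. epowr (f x) p * W x \<partial>lborel)"
proof -
  let ?F = "\<integral>\<^sup>+ x. epowr (f x) p * W x \<partial>lborel"
  let ?g = "\<lambda>k x. ennreal (inverse (2 * c) ^ k) * (maxf lborel ^^ k) f x"
  have geo: "(\<Sum>k. ennreal ((1/2) ^ k)) = 2"
  proof -
    have "(\<lambda>k. (1/2::real) ^ k) sums 2" using geometric_sums[of "1/2::real"] by simp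
    then have "(\<Sum>k. ennreal ((1/2) ^ k)) = ennreal 2" by (intro suminf_ennreal_eq) auto
    then show ?thesis by simp
  qed
  have iter: "(\<integral>\<^sup>+ x. epowr ((maxf lborel ^^ k) f x) p * W x \<partial>lborel) \<le> ennreal ((c powr p) ^ k) * ?F" for k
  proof (induction k)
    case (Suc k)
    have "(\<integral>\<^sup>+ x. epowr ((maxf lborel ^^ Suc k) f x) p * W x \<partial>lborel)
        \<le> ennreal (c powr p) * (\<integral>\<^sup>+ x. epowr ((maxf lborel ^^ k) f x) p * W x \<partial>lborel)"
      using M[of "(maxf lborel ^^ k) f"] by simp
    also have "\<dots> \<le> ennreal (c powr p) * (ennreal ((c powr p) ^ k) * ?F)"
      by (intro mult_left_mono Suc.IH) simp
    finally show ?case by (simp add: ennreal_mult mult.assoc)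
  qed simp
  have pt: "epowr (rdf_majorant c f x) p \<le> ennreal (2 powr p) * (\<Sum>k. epowr (?g k x) p)" for x
  proof -
    have "rdf_majorant c f x = (\<Sum>k. ennreal ((1/2) ^ k) * ?g k x)"
    proof -
      have "inverse (4 * c) = (1/2) * inverse (2 * c)" by simp
      then have "inverse (4 * c) ^ k = (1/2) ^ k * inverse (2 * c) ^ k" for k
        by (simp only: power_mult_distrib)
      then show ?thesis
        unfolding rdf_majorant_def using c by (simp add: ennreal_mult mult.assoc)
    qed
    also have "\<dots> \<le> (\<Sum>k. ennreal ((1/2) ^ k) * (SUP k. ?g k x))"
      by (intro suminf_le mult_left_mono SUP_upper) auto
    also have "\<dots> = 2 * (SUP k. ?g k x)"
      by (simp add: ennreal_suminf_multc geo)
    also have "(SUP k. ?g k x) \<le> epowr (\<Sum>k. epowr (?g k x) p) (1 / p)"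
    proof (rule SUP_least)
      fix k
      have "epowr (?g k x) p = (\<Sum>i\<in>{k}. epowr (?g i x) p)" by simp
      also have "\<dots> \<le> (\<Sum>k. epowr (?g k x) p)" by (rule sum_le_suminf) auto
      finally show "?g k x \<le> epowr (\<Sum>k. epowr (?g k x) p) (1 / p)"
        using p by (simp add: epowr_le_iff)
    qed
    finally have "epowr (rdf_majorant c f x) p \<le> epowr (2 * epowr (\<Sum>k. epowr (?g k x) p) (1 / p)) p"
      using p by (intro epowr_mono) (auto simp: mult_left_mono)
    also have "\<dots> = ennreal (2 powr p) * (\<Sum>k. epowr (?g k x) p)"
      using p epowr_ennreal[of 2 p] by (simp add: epowr_mult)
    finally show ?thesis .
  qed
  have "(\<integral>\<^sup>+ x. epowr (rdf_majorant c f x) p * W x \<partial>lborel)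
    \<le> (\<integral>\<^sup>+ x. ennreal (2 powr p) * (\<Sum>k. epowr (?g k x) p * W x) \<partial>lborel)"
  proof (rule nn_integral_mono)
    fix x
    have "epowr (rdf_majorant c f x) p * W x \<le> ennreal (2 powr p) * (\<Sum>k. epowr (?g k x) p) * W x"
      by (intro mult_right_mono pt) simp
    then show "epowr (rdf_majorant c f x) p * W x \<le> ennreal (2 powr p) * (\<Sum>k. epowr (?g k x) p * W x)"
      by (simp only: mult.assoc ennreal_suminf_multc)
  qed
  also have "\<dots> = ennreal (2 powr p) * (\<Sum>k. \<integral>\<^sup>+ x. epowr (?g k x) p * W x \<partial>lborel)"
    by (subst nn_integral_suminf[symmetric], measurable, subst nn_integral_cmult) auto
  also have "\<dots> \<le> ennreal (2 powr p) * (\<Sum>k. ennreal ((1/2) ^ k) * ?F)"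
  proof (intro mult_left_mono suminf_le)
    fix k
    have "(\<integral>\<^sup>+ x. epowr (?g k x) p * W x \<partial>lborel)
        = (\<integral>\<^sup>+ x. ennreal ((inverse (2 * c) ^ k) powr p) * (epowr ((maxf lborel ^^ k) f x) p * W x) \<partial>lborel)"
      using c by (simp add: epowr_mult epowr_ennreal mult.assoc)
    also have "\<dots> = ennreal ((inverse (2 * c) ^ k) powr p) * (\<integral>\<^sup>+ x. epowr ((maxf lborel ^^ k) f x) p * W x \<partial>lborel)"
      by (rule nn_integral_cmult) measurable
    also have "\<dots> \<le> ennreal ((inverse (2 * c) ^ k) powr p) * (ennreal ((c powr p) ^ k) * ?F)"
      by (intro mult_left_mono iter) simp
    also have "\<dots> = ennreal (((inverse (2 * c) ^ k) powr p) * ((c powr p) ^ k)) * ?F"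
      by (simp add: ennreal_mult mult.assoc)
    also have "\<dots> \<le> ennreal ((1/2) ^ k) * ?F"
    proof (intro mult_right_mono ennreal_leI)
      have "((inverse (2 * c) ^ k) powr p) * ((c powr p) ^ k) = ((inverse (2 * c) powr p) * (c powr p)) ^ k"
        using c by (simp add: powr_power power_mult_distrib powr_powr mult.commute flip: powr_realpow)
      also have "inverse (2 * c) powr p * c powr p = (1/2) powr p"
        using c by (subst powr_mult[symmetric]) auto
      also have "((1/2) powr p) ^ k \<le> ((1/2::real) powr 1) ^ k"
        using p by (intro power_mono powr_mono') auto
      finally show "((inverse (2 * c) ^ k) powr p) * ((c powr p) ^ k) \<le> (1/2) ^ k" by simp
    qed simp
    finally show "(\<integral>\<^sup>+ x. epowr (?g k x) p * W x \<partial>lborel) \<le> ennreal ((1/2) ^ k) * ?F" .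
  qed auto
  also have "\<dots> = ennreal (2 powr p) * 2 * ?F"
    by (simp add: ennreal_suminf_multc geo mult.assoc)
  also have "ennreal (2 powr p) * 2 = ennreal (2 powr (p + 1))"
    by (simp add: powr_add ennreal_mult)
  finally show ?thesis .
qed

text \<open>
  Averages over large intervals are positive unless \<open>f\<close> vanishes almost everywhere, so already the term
  with \<open>k = 1\<close> is positive everywhere.
\<close>

lemma rdf_majorant_pos:
  assumes c: "0 < c" and [measurable]: "f \<in> borel_measurable borel"
    and f: "\<not> (AE x in lborel. f x = 0)"
  shows "0 < rdf_majorant c f x"
proof -
  have "\<exists>N::nat. \<not> (AE y in lborel. f y * indicator {- real N<..<real N} y = 0)"
  proof (rule ccontr)
    assume "\<not> ?thesis"
    then have "AE y in lborel. \<forall>N::nat. f y * indicator {- real N<..<real N} y = 0"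
      by (subst AE_all_countable) blast
    then have "AE y in lborel. f y = 0"
    proof eventually_elim
      case (elim y)
      obtain N :: nat where "\<bar>y\<bar> < real N" using reals_Archimedean2 by blast
      with elim[rule_format, of N] show ?case by (auto simp: indicator_def split: if_splits)
    qed
    with f show False by simp
  qed
  then obtain N :: nat where N: "\<not> (AE y in lborel. f y * indicator {- real N<..<real N} y = 0)" by auto
  obtain K :: nat where K: "\<bar>x\<bar> < real K" using reals_Archimedean2 by blast
  let ?I = "{- real (N + K)<..<real (N + K)}"
  have "0 < (\<integral>\<^sup>+ y \<in> {- real N<..<real N}. f y \<partial>lborel)"
    using N by (subst zero_less_iff_neq_zero, subst nn_integral_0_iff_AE) auto
  also have "\<dots> \<le> (\<integral>\<^sup>+ y \<in> ?I. f y \<partial>lborel)"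
    by (intro nn_integral_mono) (auto simp: indicator_def)
  finally have "0 < (\<integral>\<^sup>+ y \<in> ?I. f y \<partial>lborel) / emeasure lborel ?I"
    using K by (simp add: ennreal_zero_less_divide)
  also have "\<dots> \<le> maxf lborel f x"
    using K by (intro average_le_maxf) auto
  finally have "0 < ennreal (inverse (4 * c)) * maxf lborel f x"
    using c by (simp add: ennreal_zero_less_mult_iff)
  also have "\<dots> = (\<Sum>k\<in>{1}. ennreal (inverse (4 * c) ^ k) * (maxf lborel ^^ k) f x)" by simp
  also have "\<dots> \<le> rdf_majorant c f x"
    unfolding rdf_majorant_def by (rule sum_le_suminf) auto
  finally show ?thesis .
qed

lemma A1_weight_rdf_majorant:
  assumes c: "1 \<le> c" and p: "1 \<le> p" and [measurable]: "W \<in> borel_measurable borel"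
    and W: "AE x in lborel. 0 < W x"
    and M: "\<And>f. f \<in> borel_measurable borel \<Longrightarrow>
      (\<integral>\<^sup>+ x. epowr (maxf lborel f x) p * W x \<partial>lborel) \<le> ennreal (c powr p) * (\<integral>\<^sup>+ x. epowr (f x) p * W x \<partial>lborel)"
    and [measurable]: "f \<in> borel_measurable borel"
    and f: "(\<integral>\<^sup>+ x. epowr (f x) p * W x \<partial>lborel) < top" "\<not> (AE x in lborel. f x = 0)"
  shows "A1_weight (4 * c) (rdf_majorant c f)"
  unfolding A1_weight_def
proof (intro conjI allI)
  have "(\<integral>\<^sup>+ x. epowr (rdf_majorant c f x) p * W x \<partial>lborel)
    \<le> ennreal (2 powr (p + 1)) * (\<integral>\<^sup>+ x. epowr (f x) p * W x \<partial>lborel)"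
    by (intro rdf_majorant_norm_le c p M) auto
  also have "\<dots> < top" using f by (simp add: ennreal_mult_less_top)
  finally have "AE x in lborel. epowr (rdf_majorant c f x) p * W x \<noteq> \<infinity>"
    by (intro nn_integral_noteq_infinite) auto
  with W show "AE x in lborel. rdf_majorant c f x < \<infinity>"
    by eventually_elim (auto simp: ennreal_mult_eq_top_iff less_top[symmetric])
  show "0 < rdf_majorant c f x" for x using c f by (intro rdf_majorant_pos) auto
  show "maxf lborel (rdf_majorant c f) x \<le> ennreal (4 * c) * rdf_majorant c f x" for x
    using c by (intro maxf_rdf_majorant_le) auto
qed measurable

text \<open>
  The elementary substitute for Hoelder's inequality in the extrapolation argument: either \<open>g \<le> u\<close>, or
  the factor \<open>(g / u)\<^sup>p\<^sup>-\<^sup>1\<close> is at least \<open>1\<close>.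
\<close>

lemma le_epowr_div_add:
  assumes "1 < p" and u: "0 < u" "u < top"
  shows "g \<le> epowr g p * inverse (epowr u (p - 1)) + u"
proof (cases "g \<le> u")
  case False
  have "g = g * (epowr u (p - 1) * inverse (epowr u (p - 1)))"
    using u inverse_mult_self_ennreal[of "epowr u (p - 1)"] by (simp add: mult.commute)
  also have "\<dots> \<le> g * (epowr g (p - 1) * inverse (epowr u (p - 1)))"
    using False assms(1) by (intro mult_left_mono mult_right_mono epowr_mono) auto
  also have "\<dots> = epowr g p * inverse (epowr u (p - 1))"
    using epowr_add[of g 1 "p - 1"] by (simp add: mult.assoc)
  finally show ?thesis by (simp add: add_increasing2)
qed (simp add: add_increasing)

lemma epowr_div_le:
  assumes "1 < p" and "f \<le> u"
  shows "epowr f p * inverse (epowr u (p - 1)) \<le> u"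
proof -
  have "epowr f p * inverse (epowr u (p - 1)) \<le> epowr u p * inverse (epowr u (p - 1))"
    using assms by (intro mult_right_mono epowr_mono) auto
  also have "\<dots> = u * (inverse (epowr u (p - 1)) * epowr u (p - 1))"
    using epowr_add[of u 1 "p - 1"] by (simp add: mult_ac)
  also have "\<dots> \<le> u * 1" by (intro mult_left_mono inverse_mult_self_ennreal_le_1) simp
  finally show ?thesis by simp
qed

lemma young_epowr:
  assumes p: "1 < p"
  shows "x * y \<le> epowr x p + epowr y (p / (p - 1))"
proof (cases "y \<le> epowr x (p - 1)")
  case True
  then have "x * y \<le> x * epowr x (p - 1)" by (rule mult_left_mono) simp
  also have "\<dots> = epowr x p" using epowr_add[of x 1 "p - 1"] by simp
  finally show ?thesis by (simp add: add_increasing2)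
next
  case False
  then have "x \<le> epowr y (1 / (p - 1))" 
    using p epowr_le_iff[of "p - 1" x y] by (metis diff_gt_0_iff_gt nle_le)
  then have "x * y \<le> epowr y (1 / (p - 1)) * y" by (rule mult_right_mono) simp
  also have "\<dots> = epowr y (1 / (p - 1) + 1)" by (simp add: epowr_add)
  also have "1 / (p - 1) + 1 = p / (p - 1)" using p by (simp add: field_simps)
  finally show ?thesis by (simp add: add_increasing)
qed

text \<open>
  Duality of the weights means \<open>w\<^bsup>1/p\<^esup> \<sigma>\<^bsup>1/q\<^esup> = 1\<close>, so \<open>a b\<close> is the product of \<open>K a w\<^bsup>1/p\<^esup>\<close> and
  \<open>K\<^sup>-\<^sup>1 b \<sigma>\<^bsup>1/q\<^esup>\<close>. The parameter \<open>K\<close> is there to make one of the two terms small.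
\<close>

lemma weighted_young:
  assumes p: "1 < p" and K: "0 < K" and dual: "epowr w (1 / (p - 1)) * \<sigma> = 1"
  shows "a * b \<le> ennreal (K powr p) * (epowr a p * w)
    + ennreal (inverse (K powr (p / (p - 1)))) * (epowr b (p / (p - 1)) * \<sigma>)"
proof -
  define q where "q = p / (p - 1)"
  note q = conjugate_exponent[OF p q_def]
  have "epowr w (1 / p) * epowr \<sigma> (1 / q) = epowr (epowr w (1 / (p - 1)) * \<sigma>) (1 / q)"
    using p q by (simp add: epowr_mult epowr_epowr q_def)
  then have one: "epowr w (1 / p) * epowr \<sigma> (1 / q) = 1" by (simp add: dual)
  have "ennreal K * ennreal (inverse K) = 1" using K by (simp flip: ennreal_mult)
  then have "a * b = (ennreal K * a * epowr w (1 / p)) * (ennreal (inverse K) * b * epowr \<sigma> (1 / q))"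
    using one by (metis (no_types, lifting) mult.assoc mult.left_commute mult.right_neutral)
  also have "\<dots> \<le> epowr (ennreal K * a * epowr w (1 / p)) p + epowr (ennreal (inverse K) * b * epowr \<sigma> (1 / q)) q"
    unfolding q_def by (rule young_epowr[OF p])
  also have "\<dots> = ennreal (K powr p) * (epowr a p * w) + ennreal (inverse (K powr q)) * (epowr b q * \<sigma>)"
    using K q by (simp add: epowr_mult epowr_ennreal mult.assoc powr_def ln_inverse exp_minus)
  finally show ?thesis by (simp add: q_def)
qed


text \<open>
  The heart of extrapolation. Here \<open>h\<close> stands for \<open>g\<^sup>p w\<close>, truncated so as to have finite integral. It is at
  most \<open>g k\<close>, where \<open>k = h\<^bsup>1/q\<^esup> w\<^bsup>1/p\<^esup>\<close> satisfies \<open>\<integral> k\<^sup>q \<sigma> = \<integral> h\<close>. The majorants \<open>u\<close> of \<open>f\<close>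
  and \<open>v\<close> of \<open>k\<close> are \<open>A\<^sub>1\<close> weights, so the hypothesis at the exponent \<open>r\<close> applies to \<open>v u\<^sup>1\<^sup>-\<^sup>r\<close>. It
  bounds \<open>\<integral> g v\<close> by a multiple of \<open>\<integral> u v\<close>, because \<open>f\<^sup>r u\<^sup>1\<^sup>-\<^sup>r \<le> u\<close>. Young's inequality brings back
  the norms of \<open>u\<close> and \<open>v\<close>, i.e. those of \<open>f\<close> and \<open>k\<close>.
\<close>

lemma extrapolation_estimate:
  assumes p: "1 < p" and r: "1 < r" and c: "1 \<le> c" and N: "0 \<le> N"
    and [measurable]: "f \<in> borel_measurable borel" "g \<in> borel_measurable borel"
      "w \<in> borel_measurable borel" "\<sigma> \<in> borel_measurable borel"
    and pos: "AE x in lborel. 0 < w x \<and> 0 < \<sigma> x"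
    and dual: "AE x in lborel. epowr (w x) (1 / (p - 1)) * \<sigma> x = 1"
    and Mw: "\<And>f. f \<in> borel_measurable borel \<Longrightarrow> (\<integral>\<^sup>+ x. epowr (maxf lborel f x) p * w x \<partial>lborel)
      \<le> ennreal (c powr p) * (\<integral>\<^sup>+ x. epowr (f x) p * w x \<partial>lborel)"
    and M\<sigma>: "\<And>f. f \<in> borel_measurable borel \<Longrightarrow> (\<integral>\<^sup>+ x. epowr (maxf lborel f x) (p / (p - 1)) * \<sigma> x \<partial>lborel)
      \<le> ennreal (c powr (p / (p - 1))) * (\<integral>\<^sup>+ x. epowr (f x) (p / (p - 1)) * \<sigma> x \<partial>lborel)"
    and base: "\<And>u v. A1_weight (4 * c) u \<Longrightarrow> A1_weight (4 * c) v \<Longrightarrow>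
      (\<integral>\<^sup>+ x. epowr (g x) r * factored_weight r u v x \<partial>lborel)
        \<le> ennreal N * (\<integral>\<^sup>+ x. epowr (f x) r * factored_weight r u v x \<partial>lborel)"
    and f: "(\<integral>\<^sup>+ x. epowr (f x) p * w x \<partial>lborel) < top" "\<not> (AE x in lborel. f x = 0)"
    and [measurable]: "h \<in> borel_measurable borel"
    and h: "\<And>x. h x \<le> epowr (g x) p * w x" "(\<integral>\<^sup>+ x. h x \<partial>lborel) < top"
    and K: "0 < K"
  shows "(\<integral>\<^sup>+ x. h x \<partial>lborel) \<le> ennreal (N + 1) *
    (ennreal (K powr p * 2 powr (p + 1)) * (\<integral>\<^sup>+ x. epowr (f x) p * w x \<partial>lborel)
     + ennreal (inverse (K powr (p / (p - 1))) * 2 powr (p / (p - 1) + 1)) * (\<integral>\<^sup>+ x. h x \<partial>lborel))"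
proof -
  define q where "q = p / (p - 1)"
  note q = conjugate_exponent[OF p q_def]
  define k where "k = (\<lambda>x. epowr (h x) (1 / q) * epowr (w x) (1 / p))"
  have [measurable]: "k \<in> borel_measurable borel" unfolding k_def by measurable
  have k_norm: "(\<integral>\<^sup>+ x. epowr (k x) q * \<sigma> x \<partial>lborel) = (\<integral>\<^sup>+ x. h x \<partial>lborel)"
  proof (rule nn_integral_cong_AE)
    show "AE x in lborel. epowr (k x) q * \<sigma> x = h x"
      using dual
    proof eventually_elim
      case (elim x)
      have "epowr (k x) q * \<sigma> x = h x * (epowr (w x) (1 / (p - 1)) * \<sigma> x)"
        using q p by (simp add: k_def epowr_mult epowr_epowr mult.assoc)
      with elim show ?case by simp
    qed
  qed
  have h_le: "h x \<le> g x * k x" for x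
  proof -
    have "h x = epowr (h x) (1 / p) * epowr (h x) (1 / q)"
      using q by (simp flip: epowr_add)
    also have "\<dots> \<le> epowr (epowr (g x) p * w x) (1 / p) * epowr (h x) (1 / q)"
      using h(1) p by (intro mult_right_mono epowr_mono) auto
    also have "\<dots> = g x * k x"
      using p by (simp add: k_def epowr_mult mult_ac)
    finally show ?thesis .
  qed
  show ?thesis
  proof (cases "AE x in lborel. k x = 0")
    case True
    then have "AE x in lborel. h x = 0"
      by eventually_elim (use h_le in \<open>metis mult_zero_right le_zero_eq\<close>)
    then have "(\<integral>\<^sup>+ x. h x \<partial>lborel) = 0" by (subst nn_integral_0_iff_AE) auto
    then show ?thesis by simp
  next
    case False
    define u where "u = rdf_majorant c f"
    define v where "v = rdf_majorant c k"
    have u: "A1_weight (4 * c) u" unfolding u_def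
      using pos p by (intro A1_weight_rdf_majorant[of c p w] c Mw f) (auto elim!: eventually_mono)
    have v: "A1_weight (4 * c) v" unfolding v_def
      using pos q False h(2) by (intro A1_weight_rdf_majorant[of c q \<sigma>] c)
        (auto elim!: eventually_mono simp: k_norm intro!: M\<sigma>[folded q_def])
    note [measurable] = A1_weightD(1)[OF u] A1_weightD(1)[OF v]
    have "(\<integral>\<^sup>+ x. h x \<partial>lborel) \<le> (\<integral>\<^sup>+ x. epowr (g x) r * factored_weight r u v x + u x * v x \<partial>lborel)"
    proof (rule nn_integral_mono_AE)
      show "AE x in lborel. h x \<le> epowr (g x) r * factored_weight r u v x + u x * v x"
        using A1_weightD(3)[OF u]
      proof eventually_elim
        case (elim x)
        have "h x \<le> g x * v x"
          using h_le le_rdf_majorant unfolding v_def by (meson mult_left_mono order_trans zero_le)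
        also have "\<dots> \<le> (epowr (g x) r * inverse (epowr (u x) (r - 1)) + u x) * v x"
          using elim A1_weightD(2)[OF u] r by (intro mult_right_mono le_epowr_div_add) auto
        also have "\<dots> = epowr (g x) r * factored_weight r u v x + u x * v x"
          unfolding factored_weight_def distrib_right by (simp only: mult_ac)
        finally show ?case .
      qed
    qed
    also have "\<dots> = (\<integral>\<^sup>+ x. epowr (g x) r * factored_weight r u v x \<partial>lborel) + (\<integral>\<^sup>+ x. u x * v x \<partial>lborel)"
      by (rule nn_integral_add) measurable
    also have "(\<integral>\<^sup>+ x. epowr (g x) r * factored_weight r u v x \<partial>lborel) \<le> ennreal N * (\<integral>\<^sup>+ x. u x * v x \<partial>lborel)"
    proof -
      have "epowr (f x) r * factored_weight r u v x \<le> u x * v x" for x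
        using mult_right_mono[OF epowr_div_le[OF r le_rdf_majorant, of f x c], of "v x"]
        by (simp add: u_def factored_weight_def mult_ac)
      then have "(\<integral>\<^sup>+ x. epowr (f x) r * factored_weight r u v x \<partial>lborel) \<le> (\<integral>\<^sup>+ x. u x * v x \<partial>lborel)"
        by (rule nn_integral_mono)
      then show ?thesis using base[OF u v] by (meson mult_left_mono order_trans zero_le)
    qed
    also have "ennreal N * (\<integral>\<^sup>+ x. u x * v x \<partial>lborel) + (\<integral>\<^sup>+ x. u x * v x \<partial>lborel)
        = ennreal (N + 1) * (\<integral>\<^sup>+ x. u x * v x \<partial>lborel)"
      using N by (simp add: distrib_right)
    also have "(\<integral>\<^sup>+ x. u x * v x \<partial>lborel) \<le> (\<integral>\<^sup>+ x. ennreal (K powr p) * (epowr (u x) p * w x)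
        + ennreal (inverse (K powr q)) * (epowr (v x) q * \<sigma> x) \<partial>lborel)"
      using dual unfolding q_def by (intro nn_integral_mono_AE) (auto elim!: eventually_mono intro!: weighted_young p K)
    also have "\<dots> = ennreal (K powr p) * (\<integral>\<^sup>+ x. epowr (u x) p * w x \<partial>lborel)
        + ennreal (inverse (K powr q)) * (\<integral>\<^sup>+ x. epowr (v x) q * \<sigma> x \<partial>lborel)"
      by (simp add: nn_integral_add nn_integral_cmult)
    also have "\<dots> \<le> ennreal (K powr p) * (ennreal (2 powr (p + 1)) * (\<integral>\<^sup>+ x. epowr (f x) p * w x \<partial>lborel))
        + ennreal (inverse (K powr q)) * (ennreal (2 powr (q + 1)) * (\<integral>\<^sup>+ x. epowr (k x) q * \<sigma> x \<partial>lborel))"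
      unfolding u_def v_def using p q M\<sigma>[folded q_def]
      by (intro add_mono mult_left_mono rdf_majorant_norm_le c Mw) auto
    finally show ?thesis
      using K by (simp add: k_norm q_def[symmetric] ennreal_mult mult.assoc mult_left_mono)
  qed
qed

text \<open>
  In the estimate above, \<open>K\<close> is chosen such that the term with \<open>\<integral> h\<close> on the right is half of the left-hand
  side. As \<open>\<integral> h\<close> is finite, it can be absorbed, and monotone convergence removes the truncation.
\<close>

theorem extrapolation:
  assumes base: "weighted_bound r \<F>" and r: "1 < r" and p: "1 < p"
    and \<F>: "\<And>g f. (g, f) \<in> \<F> \<Longrightarrow> g \<in> borel_measurable borel \<and> f \<in> borel_measurable borel"
  shows "weighted_bound p \<F>"
  unfolding weighted_bound_def
proof (intro allI impI)
  fix A :: real assume A: "0 < A"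
  define q where "q = p / (p - 1)"
  note q = conjugate_exponent[OF p q_def]
  obtain N1 where N1: "\<And>u v f. A1_weight A u \<Longrightarrow> A1_weight A v \<Longrightarrow> f \<in> borel_measurable borel \<Longrightarrow>
      (\<integral>\<^sup>+ x. epowr (maxf lborel f x) p * factored_weight p u v x \<partial>lborel)
        \<le> ennreal N1 * (\<integral>\<^sup>+ x. epowr (f x) p * factored_weight p u v x \<partial>lborel)"
    using muckenhoupt[OF p] A unfolding weighted_bound_def by fast
  obtain N2 where N2: "\<And>u v f. A1_weight A u \<Longrightarrow> A1_weight A v \<Longrightarrow> f \<in> borel_measurable borel \<Longrightarrow>
      (\<integral>\<^sup>+ x. epowr (maxf lborel f x) q * factored_weight q u v x \<partial>lborel)
        \<le> ennreal N2 * (\<integral>\<^sup>+ x. epowr (f x) q * factored_weight q u v x \<partial>lborel)"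
    using muckenhoupt[OF q(1)] A unfolding weighted_bound_def by fast
  define c where "c = max 1 (max N1 N2)"
  have c: "1 \<le> c" "N1 \<le> c powr p" "N2 \<le> c powr q"
  proof -
    show c1: "1 \<le> c" by (simp add: c_def)
    have "c \<le> c powr p" "c \<le> c powr q"
      using c1 p q powr_mono[of 1 p c] powr_mono[of 1 q c] by auto
    then show "N1 \<le> c powr p" "N2 \<le> c powr q" by (auto simp: c_def)
  qed
  obtain N' where N': "\<And>u v g f. A1_weight (4 * c) u \<Longrightarrow> A1_weight (4 * c) v \<Longrightarrow> (g, f) \<in> \<F> \<Longrightarrow>
      (\<integral>\<^sup>+ x. epowr (g x) r * factored_weight r u v x \<partial>lborel)
        \<le> ennreal N' * (\<integral>\<^sup>+ x. epowr (f x) r * factored_weight r u v x \<partial>lborel)"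
    using base[unfolded weighted_bound_def, rule_format, of "4 * c"] c(1) by fastforce
  define N where "N = max 0 N'"
  have N: "0 \<le> N" and base_N: "\<And>u v g f. A1_weight (4 * c) u \<Longrightarrow> A1_weight (4 * c) v \<Longrightarrow> (g, f) \<in> \<F> \<Longrightarrow>
      (\<integral>\<^sup>+ x. epowr (g x) r * factored_weight r u v x \<partial>lborel)
        \<le> ennreal N * (\<integral>\<^sup>+ x. epowr (f x) r * factored_weight r u v x \<partial>lborel)"
  proof -
    show "0 \<le> N" by (simp add: N_def)
    fix u v g f assume *: "A1_weight (4 * c) u" "A1_weight (4 * c) v" "(g, f) \<in> \<F>"
    have "ennreal N' \<le> ennreal N" by (intro ennreal_leI) (simp add: N_def)
    then show "(\<integral>\<^sup>+ x. epowr (g x) r * factored_weight r u v x \<partial>lborel)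
        \<le> ennreal N * (\<integral>\<^sup>+ x. epowr (f x) r * factored_weight r u v x \<partial>lborel)"
      using N'[OF *] by (meson mult_right_mono order_trans zero_le)
  qed
  \<comment> \<open>The trivial weight settles the case that \<open>f\<close> vanishes almost everywhere, where there is no majorant.\<close>
  obtain N0 where N0: "\<And>g f. (g, f) \<in> \<F> \<Longrightarrow>
      (\<integral>\<^sup>+ x. epowr (g x) r \<partial>lborel) \<le> ennreal N0 * (\<integral>\<^sup>+ x. epowr (f x) r \<partial>lborel)"
  proof -
    obtain N0 where "\<forall>u v. A1_weight 1 u \<longrightarrow> A1_weight 1 v \<longrightarrow>
     (\<forall>(g, f) \<in> \<F>. (\<integral>\<^sup>+ x. epowr (g x) r * factored_weight r u v x \<partial>lborel)
        \<le> ennreal N0 * (\<integral>\<^sup>+ x. epowr (f x) r * factored_weight r u v x \<partial>lborel))"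
      using base zero_less_one unfolding weighted_bound_def by blast
    from this[rule_format, OF A1_weight_one A1_weight_one] that[of N0] show ?thesis
      by (auto simp: factored_weight_def)
  qed
  define K where "K = (4 * (N + 1) * 2 powr q) powr (1 / q)"
  have K: "0 < K" "K powr q = 4 * (N + 1) * 2 powr q"
    using N q by (auto simp: K_def powr_powr)
  define C where "C = 2 * (N + 1) * (K powr p * 2 powr (p + 1))"
  have C: "0 < C" using N K by (simp add: C_def)
  show "\<exists>N::real. \<forall>u v. A1_weight A u \<longrightarrow> A1_weight A v \<longrightarrow>
     (\<forall>(g, f) \<in> \<F>. (\<integral>\<^sup>+ x. epowr (g x) p * factored_weight p u v x \<partial>lborel)
        \<le> ennreal N * (\<integral>\<^sup>+ x. epowr (f x) p * factored_weight p u v x \<partial>lborel))"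
  proof (intro exI[of _ C] allI impI ballI, clarify)
    fix u v g f assume u: "A1_weight A u" and v: "A1_weight A v" and gf: "(g, f) \<in> \<F>"
    note [measurable] = A1_weightD(1)[OF u] A1_weightD(1)[OF v]
    have [measurable]: "g \<in> borel_measurable borel" "f \<in> borel_measurable borel" using \<F>[OF gf] by auto
    define w where "w = factored_weight p u v"
    define \<sigma> where "\<sigma> = factored_weight q v u"
    have [measurable]: "w \<in> borel_measurable borel" "\<sigma> \<in> borel_measurable borel"
      unfolding w_def \<sigma>_def by measurable
    have ae: "AE x in lborel. 0 < w x \<and> 0 < \<sigma> x \<and> w x < top \<and> epowr (w x) (1 / (p - 1)) * \<sigma> x = 1"
      using A1_weightD(3)[OF u] A1_weightD(3)[OF v]
    proof eventually_elim
      case (elim x)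
      then show ?case
        using A1_weightD(2)[OF u, of x] A1_weightD(2)[OF v, of x] factored_weight_dual(1)[of q v x u] q p
        by (auto simp: w_def \<sigma>_def intro!: factored_weight_pos factored_weight_finite)
    qed
    have Mw: "(\<integral>\<^sup>+ x. epowr (maxf lborel f x) p * w x \<partial>lborel)
      \<le> ennreal (c powr p) * (\<integral>\<^sup>+ x. epowr (f x) p * w x \<partial>lborel)" if "f \<in> borel_measurable borel" for f
      using N1[OF u v that] c(2) unfolding w_def
      by (meson ennreal_leI mult_right_mono order_trans zero_le)
    have M\<sigma>: "(\<integral>\<^sup>+ x. epowr (maxf lborel f x) q * \<sigma> x \<partial>lborel)
      \<le> ennreal (c powr q) * (\<integral>\<^sup>+ x. epowr (f x) q * \<sigma> x \<partial>lborel)" if "f \<in> borel_measurable borel" for f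
      using N2[OF v u that] c(3) unfolding \<sigma>_def
      by (meson ennreal_leI mult_right_mono order_trans zero_le)
    let ?F = "\<integral>\<^sup>+ x. epowr (f x) p * w x \<partial>lborel"
    have "(\<integral>\<^sup>+ x. epowr (g x) p * w x \<partial>lborel) \<le> ennreal C * ?F"
    proof (cases "?F < top")
      case False
      then show ?thesis using C by (simp add: less_top[symmetric] ennreal_mult_top)
    next
      case F: True
      show ?thesis
      proof (cases "AE x in lborel. f x = 0")
        case True
        then have "(\<integral>\<^sup>+ x. epowr (f x) r \<partial>lborel) = 0"
          by (subst nn_integral_0_iff_AE) (auto elim!: eventually_mono)
        with N0[OF gf] have "(\<integral>\<^sup>+ x. epowr (g x) r \<partial>lborel) = 0" by simp
        then have "AE x in lborel. g x = 0" by (subst (asm) nn_integral_0_iff_AE) auto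
        then have "(\<integral>\<^sup>+ x. epowr (g x) p * w x \<partial>lborel) = 0"
          by (subst nn_integral_0_iff_AE) (auto elim!: eventually_mono)
        then show ?thesis by simp
      next
        case f: False
        define h where "h = (\<lambda>(n::nat) x. min (epowr (g x) p * w x) (of_nat n) * indicator {- real n..real n} x)"
        have [measurable]: "h n \<in> borel_measurable borel" for n unfolding h_def by measurable
        have h_le: "h n x \<le> epowr (g x) p * w x" for n x
          by (auto simp: h_def indicator_def)
        have h_fin: "(\<integral>\<^sup>+ x. h n x \<partial>lborel) < top" for n
        proof -
          have "(\<integral>\<^sup>+ x. h n x \<partial>lborel) \<le> (\<integral>\<^sup>+ x. of_nat n * indicator {- real n..real n} x \<partial>lborel)"
            by (intro nn_integral_mono) (auto simp: h_def indicator_def)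
          also have "\<dots> < top" by (simp add: nn_integral_cmult_indicator ennreal_mult_less_top of_nat_less_top)
          finally show ?thesis .
        qed
        have bound: "(\<integral>\<^sup>+ x. h n x \<partial>lborel) \<le> ennreal C * ?F" for n
        proof -
          let ?H = "\<integral>\<^sup>+ x. h n x \<partial>lborel"
          have "?H \<le> ennreal (N + 1) * (ennreal (K powr p * 2 powr (p + 1)) * ?F
            + ennreal (inverse (K powr (p / (p - 1))) * 2 powr (p / (p - 1) + 1)) * ?H)"
          proof (rule extrapolation_estimate[where r = r])
            show "AE x in lborel. 0 < w x \<and> 0 < \<sigma> x" "AE x in lborel. epowr (w x) (1 / (p - 1)) * \<sigma> x = 1"
              using ae by (auto elim!: eventually_mono)
            show "f \<in> borel_measurable borel" "g \<in> borel_measurable borel" "w \<in> borel_measurable borel"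
              "\<sigma> \<in> borel_measurable borel" "h n \<in> borel_measurable borel" by measurable
            show "(\<integral>\<^sup>+ x. epowr (maxf lborel f x) (p / (p - 1)) * \<sigma> x \<partial>lborel)
              \<le> ennreal (c powr (p / (p - 1))) * (\<integral>\<^sup>+ x. epowr (f x) (p / (p - 1)) * \<sigma> x \<partial>lborel)"
              if "f \<in> borel_measurable borel" for f
              using M\<sigma>[OF that] by (simp add: q_def)
            show "(\<integral>\<^sup>+ x. epowr (g x) r * factored_weight r u v x \<partial>lborel)
                \<le> ennreal N * (\<integral>\<^sup>+ x. epowr (f x) r * factored_weight r u v x \<partial>lborel)"
              if "A1_weight (4 * c) u" "A1_weight (4 * c) v" for u v
              by (rule base_N[OF that gf])
          qed (fact p r c(1) N K(1) F f h_le h_fin Mw)+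
          moreover obtain F' where F': "?F = ennreal F'" "0 \<le> F'" using F by (cases ?F) auto
          moreover obtain H' where H': "?H = ennreal H'" "0 \<le> H'" using h_fin[of n] by (cases ?H) auto
          ultimately have "ennreal H' \<le> ennreal ((N + 1) * ((K powr p * 2 powr (p + 1)) * F'
            + (inverse (K powr q) * 2 powr (q + 1)) * H'))"
            using N K by (simp add: q_def[symmetric] ennreal_mult ennreal_plus del: ennreal_plus[symmetric])
          then have "H' \<le> (N + 1) * ((K powr p * 2 powr (p + 1)) * F' + (inverse (K powr q) * 2 powr (q + 1)) * H')"
            using N F' H' by (subst (asm) ennreal_le_iff) auto
          also have "\<dots> = C * F' / 2 + H' / 2"
          proof -
            have "a * (inverse (4 * a * b) * (b * 2)) = 1 / 2" if "a \<noteq> 0" "b \<noteq> 0" for a b :: real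
              using that by (simp add: field_simps)
            from this[of "N + 1" "2 powr q"] N have "(N + 1) * (inverse (K powr q) * 2 powr (q + 1)) = 1 / 2"
              unfolding K(2) powr_add by simp
            then have half: "(N + 1) * (inverse (K powr q) * 2 powr (q + 1) * H') = H' / 2"
              by (metis mult.assoc mult.left_neutral times_divide_eq_left)
            have "(N + 1) * (X * F') + H' / 2 = 2 * (N + 1) * X * F' / 2 + H' / 2" for X
              by (simp only: mult.assoc)
            then show ?thesis unfolding distrib_left[of "N + 1"] half C_def .
          qed
          finally have "H' \<le> C * F'" by simp
          then show ?thesis using F' H' C by (simp flip: ennreal_mult add: ennreal_leI)
        qed
        have "(\<integral>\<^sup>+ x. epowr (g x) p * w x \<partial>lborel) = (\<integral>\<^sup>+ x. (SUP n. h n x) \<partial>lborel)"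
        proof (rule nn_integral_cong)
          fix x
          let ?y = "epowr (g x) p * w x"
          show "?y = (SUP n. h n x)"
          proof (rule antisym)
            show "(SUP n. h n x) \<le> ?y" using h_le by (intro SUP_least)
            show "?y \<le> (SUP n. h n x)"
            proof (rule dense_le)
              fix z assume z: "z < ?y"
              then have "z < top" by (rule less_le_trans) simp
              then obtain n1 where n1: "z < of_nat n1" using ennreal_Ex_less_of_nat by blast
              obtain n2 :: nat where n2: "\<bar>x\<bar> \<le> real n2" using real_arch_simple by blast
              have "of_nat n1 \<le> (of_nat (max n1 n2) :: ennreal)" by (intro of_nat_mono) simp
              with n1 z have "z \<le> min ?y (of_nat (max n1 n2))" by (simp add: order_less_imp_le order_less_le_trans)
              moreover have "x \<in> {- real (max n1 n2)..real (max n1 n2)}" using n2 by auto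
              ultimately have "z \<le> h (max n1 n2) x" by (simp add: h_def)
              then show "z \<le> (SUP n. h n x)" by (rule SUP_upper2[OF UNIV_I])
            qed
          qed
        qed
        also have "\<dots> = (SUP n. \<integral>\<^sup>+ x. h n x \<partial>lborel)"
        proof (rule nn_integral_monotone_convergence_SUP)
          show "incseq h"
            unfolding incseq_def le_fun_def
          proof (intro allI impI)
            fix m n :: nat and x assume "m \<le> n"
            then show "h m x \<le> h n x"
              unfolding h_def by (intro mult_mono min.mono of_nat_mono) (auto simp: indicator_def)
          qed
        qed auto
        also have "\<dots> \<le> ennreal C * ?F" by (intro SUP_least bound)
        finally show ?thesis .
      qed
    qed
    then show "(\<integral>\<^sup>+ x. epowr (g x) p * factored_weight p u v x \<partial>lborel)
        \<le> ennreal C * (\<integral>\<^sup>+ x. epowr (f x) p * factored_weight p u v x \<partial>lborel)"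
      by (simp add: w_def)
  qed
qed

section \<open>Iterated norms and one-dimensional maximal operators\<close>

text \<open>
  Borel functions are considered on the whole space \<open>nat \<Rightarrow> real\<close>, in which overwriting a coordinate is
  always possible.
\<close>

abbreviation points :: "(nat \<Rightarrow> real) measure" where
  "points \<equiv> PiM UNIV (\<lambda>_. borel)"

text \<open>
  The recursion of \<open>partial_norm\<close> for finite exponents. With all exponents \<open>1\<close> it is the iterated
  integral over the first \<open>k\<close> coordinates.
\<close>

primrec iter_norm ::
  "nat \<Rightarrow> (nat \<Rightarrow> real) \<Rightarrow> ((nat \<Rightarrow> real) \<Rightarrow> ennreal) \<Rightarrow> (nat \<Rightarrow> real) \<Rightarrow> ennreal" where
  "iter_norm 0 q g x = g x"
| "iter_norm (Suc k) q g x = epowr (\<integral>\<^sup>+ y. epowr (iter_norm k q g (x(Suc k := y))) (q (Suc k)) \<partial>lborel) (1 / q (Suc k))"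

definition coord_max :: "nat \<Rightarrow> ((nat \<Rightarrow> real) \<Rightarrow> ennreal) \<Rightarrow> (nat \<Rightarrow> real) \<Rightarrow> ennreal" where
  "coord_max k h x = maxf lborel (\<lambda>y. h (x(k := y))) (x k)"

lemma measurable_upd_pair [measurable]:
  "(\<lambda>(x, y). x(k := y)) \<in> points \<Otimes>\<^sub>M borel \<rightarrow>\<^sub>M points"
  using measurable_add_dim[of k UNIV "\<lambda>_. borel"] by simp

lemma measurable_upd [measurable (raw)]:
  assumes f: "f \<in> M \<rightarrow>\<^sub>M points" and g: "g \<in> borel_measurable M"
  shows "(\<lambda>z. (f z)(k := g z)) \<in> M \<rightarrow>\<^sub>M points"
  using measurable_compose[OF measurable_Pair[OF f g] measurable_upd_pair] by simp

lemma measurable_section: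
  assumes [measurable]: "h \<in> borel_measurable points"
  shows "(\<lambda>y. h (x(k := y))) \<in> borel_measurable borel"
proof -
  have [measurable]: "(\<lambda>y. x) \<in> borel \<rightarrow>\<^sub>M points" by (rule measurable_const) (simp add: space_PiM)
  show ?thesis by measurable
qed

lemma measurable_coord_max [measurable]:
  assumes [measurable]: "h \<in> borel_measurable points"
  shows "coord_max k h \<in> borel_measurable points"
proof -
  have "countable (\<rat> \<times> \<rat> :: (real \<times> real) set)" by (simp add: countable_rat)
  moreover have [measurable]: "(\<lambda>x. x k) \<in> borel_measurable points" by measurable
  ultimately show ?thesis unfolding coord_max_def[abs_def] maxf_def split_beta
    by (intro borel_measurable_SUP) (auto, measurable)
qed

lemma measurable_iter_norm [measurable]:
  assumes [measurable]: "h \<in> borel_measurable points"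
  shows "iter_norm k q h \<in> borel_measurable points"
proof (induction k)
  case (Suc k)
  note [measurable] = Suc.IH
  show ?case unfolding iter_norm.simps[abs_def] by measurable
qed simp

lemma iter_norm_le_cmult:
  assumes [measurable]: "G \<in> borel_measurable points"
    and "k \<le> m" and q: "\<And>i. i \<in> {1..m} \<Longrightarrow> 0 < q i"
    and "\<And>x. iter_norm k q F x \<le> c * iter_norm k q G x"
  shows "iter_norm m q F x \<le> c * iter_norm m q G x"
  using assms(2) q
proof (induction m arbitrary: x rule: dec_induct)
  case (step m)
  note [measurable] = measurable_section[OF measurable_iter_norm[OF assms(1)]]
  let ?q = "q (Suc m)"
  have q: "0 < ?q" using step.prems by simp
  have "iter_norm (Suc m) q F x \<le> epowr (\<integral>\<^sup>+ y. epowr (c * iter_norm m q G (x(Suc m := y))) ?q \<partial>lborel) (1 / ?q)"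
    using step q by (auto simp: less_imp_le intro!: epowr_mono nn_integral_mono)
  also have "\<dots> = c * iter_norm (Suc m) q G x"
    using q by (simp add: epowr_mult nn_integral_cmult)
  finally show ?case .
qed (simp add: assms)

text \<open>
  The pairs \<open>(G\<^sub>j, H\<^sub>j)\<close> of the introduction, for all functions \<open>h\<close> and all values of the coordinates that
  remain fixed.
\<close>

definition norm_sections ::
  "nat \<Rightarrow> nat \<Rightarrow> (nat \<Rightarrow> real) \<Rightarrow> ((real \<Rightarrow> ennreal) \<times> (real \<Rightarrow> ennreal)) set" where
  "norm_sections k j q = {(\<lambda>y. iter_norm j q (coord_max k h) (x(k := y)), \<lambda>y. iter_norm j q h (x(k := y))) | h x.
     h \<in> borel_measurable points}"

lemma iter_norm_Suc_integral:
  assumes "0 < q (Suc j)"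
  shows "epowr (iter_norm (Suc j) q h x) (q (Suc j)) = (\<integral>\<^sup>+ z. epowr (iter_norm j q h (x(Suc j := z))) (q (Suc j)) \<partial>lborel)"
  using assms by simp

text \<open>
  Tonelli's theorem carries the bound from \<open>j\<close> to \<open>j + 1\<close> for the exponent \<open>q\<^sub>j\<^sub>+\<^sub>1\<close>, since the constant for
  \<open>j\<close> is uniform in \<open>x\<^sub>j\<^sub>+\<^sub>1\<close>; extrapolation extends it to every exponent, in particular to the one needed
  in the next step.
\<close>

lemma weighted_bound_norm_sections:
  assumes "j < k" and "\<And>i. i \<in> {1..j} \<Longrightarrow> 1 < q i" and "1 < p"
  shows "weighted_bound p (norm_sections k j q)"
  using assms
proof (induction j arbitrary: p)
  case 0
  have "norm_sections k 0 q \<subseteq> {(maxf lborel f, f) | f. f \<in> borel_measurable borel}"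
    unfolding norm_sections_def coord_max_def using measurable_section by auto
  then show ?case
    using muckenhoupt[OF \<open>1 < p\<close>] unfolding weighted_bound_def by (meson subsetD)
next
  case (Suc j)
  let ?r = "q (Suc j)"
  have r: "1 < ?r" using Suc.prems by simp
  have "weighted_bound ?r (norm_sections k (Suc j) q)"
    unfolding weighted_bound_def
  proof (intro allI impI)
    fix A :: real assume A: "0 < A"
    have "weighted_bound ?r (norm_sections k j q)"
      using Suc.prems r by (intro Suc.IH) auto
    then obtain N where N: "\<And>u v g f. A1_weight A u \<Longrightarrow> A1_weight A v \<Longrightarrow> (g, f) \<in> norm_sections k j q \<Longrightarrow>
        (\<integral>\<^sup>+ x. epowr (g x) ?r * factored_weight ?r u v x \<partial>lborel)
        \<le> ennreal N * (\<integral>\<^sup>+ x. epowr (f x) ?r * factored_weight ?r u v x \<partial>lborel)"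
      using A unfolding weighted_bound_def by fast
    have "(\<integral>\<^sup>+ y. epowr (iter_norm (Suc j) q (coord_max k h) (x(k := y))) ?r * factored_weight ?r u v y \<partial>lborel)
      \<le> ennreal N * (\<integral>\<^sup>+ y. epowr (iter_norm (Suc j) q h (x(k := y))) ?r * factored_weight ?r u v y \<partial>lborel)"
      if u: "A1_weight A u" and v: "A1_weight A v" and h [measurable]: "h \<in> borel_measurable points" for u v h x
    proof -
      note [measurable] = A1_weightD(1)[OF u] A1_weightD(1)[OF v]
      have swap: "(\<integral>\<^sup>+ y. epowr (iter_norm (Suc j) q g (x(k := y))) ?r * factored_weight ?r u v y \<partial>lborel)
        = (\<integral>\<^sup>+ z. (\<integral>\<^sup>+ y. epowr (iter_norm j q g ((x(Suc j := z))(k := y))) ?r * factored_weight ?r u v y \<partial>lborel) \<partial>lborel)"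
        if [measurable]: "g \<in> borel_measurable points" for g
      proof -
        have ne: "k \<noteq> Suc j" using Suc.prems by simp
        have [measurable]: "(\<lambda>_. x) \<in> M \<rightarrow>\<^sub>M points" for M :: "'z measure" by (rule measurable_const) (simp add: space_PiM)
        have "(\<integral>\<^sup>+ y. epowr (iter_norm (Suc j) q g (x(k := y))) ?r * factored_weight ?r u v y \<partial>lborel)
          = (\<integral>\<^sup>+ y. (\<integral>\<^sup>+ z. epowr (iter_norm j q g ((x(k := y))(Suc j := z))) ?r * factored_weight ?r u v y \<partial>lborel) \<partial>lborel)"
          using r by (intro nn_integral_cong, subst iter_norm_Suc_integral, simp, subst nn_integral_multc)
            (auto intro!: measurable_compose[OF measurable_section] measurable_epowr measurable_section)
        also have "\<dots> = (\<integral>\<^sup>+ z. (\<integral>\<^sup>+ y. epowr (iter_norm j q g ((x(k := y))(Suc j := z))) ?r * factored_weight ?r u v y \<partial>lborel) \<partial>lborel)"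
          by (rule lborel_pair.Fubini') measurable
        finally show ?thesis using ne by (simp add: fun_upd_twist)
      qed
      have "(\<integral>\<^sup>+ z. (\<integral>\<^sup>+ y. epowr (iter_norm j q (coord_max k h) ((x(Suc j := z))(k := y))) ?r * factored_weight ?r u v y \<partial>lborel) \<partial>lborel)
        \<le> (\<integral>\<^sup>+ z. ennreal N * (\<integral>\<^sup>+ y. epowr (iter_norm j q h ((x(Suc j := z))(k := y))) ?r * factored_weight ?r u v y \<partial>lborel) \<partial>lborel)"
        by (intro nn_integral_mono N u v) (use h in \<open>auto simp: norm_sections_def\<close>)
      also have "\<dots> = ennreal N * (\<integral>\<^sup>+ z. (\<integral>\<^sup>+ y. epowr (iter_norm j q h ((x(Suc j := z))(k := y))) ?r * factored_weight ?r u v y \<partial>lborel) \<partial>lborel)"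
      proof (rule nn_integral_cmult)
        have [measurable]: "(\<lambda>_. x) \<in> M \<rightarrow>\<^sub>M points" for M :: "'z measure" by (rule measurable_const) (simp add: space_PiM)
        show "(\<lambda>z. \<integral>\<^sup>+ y. epowr (iter_norm j q h ((x(Suc j := z))(k := y))) ?r * factored_weight ?r u v y \<partial>lborel) \<in> borel_measurable lborel"
          by measurable
      qed
      finally show ?thesis by (simp only: swap h measurable_coord_max)
    qed
    then show "\<exists>N::real. \<forall>u v. A1_weight A u \<longrightarrow> A1_weight A v \<longrightarrow>
      (\<forall>(g, f) \<in> norm_sections k (Suc j) q. (\<integral>\<^sup>+ x. epowr (g x) ?r * factored_weight ?r u v x \<partial>lborel)
        \<le> ennreal N * (\<integral>\<^sup>+ x. epowr (f x) ?r * factored_weight ?r u v x \<partial>lborel))"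
      unfolding norm_sections_def by (intro exI[of _ N]) blast
  qed
  then show ?case
    by (rule extrapolation[OF _ r \<open>1 < p\<close>])
      (auto simp del: iter_norm.simps simp: norm_sections_def intro!: measurable_section measurable_iter_norm measurable_coord_max)
qed

lemma coord_max_iter_norm_bound:
  assumes q: "\<And>i. i \<in> {1..Suc j} \<Longrightarrow> 1 < q i"
  shows "\<exists>C::real. \<forall>h\<in>borel_measurable points. \<forall>x.
    iter_norm (Suc j) q (coord_max (Suc j) h) x \<le> ennreal C * iter_norm (Suc j) q h x"
proof -
  let ?r = "q (Suc j)"
  have r: "1 < ?r" using q by simp
  have "weighted_bound ?r (norm_sections (Suc j) j q)"
    using q by (intro weighted_bound_norm_sections) auto
  then obtain N where "\<forall>u v. A1_weight 1 u \<longrightarrow> A1_weight 1 v \<longrightarrow>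
     (\<forall>(g, f) \<in> norm_sections (Suc j) j q. (\<integral>\<^sup>+ x. epowr (g x) ?r * factored_weight ?r u v x \<partial>lborel)
        \<le> ennreal N * (\<integral>\<^sup>+ x. epowr (f x) ?r * factored_weight ?r u v x \<partial>lborel))"
    unfolding weighted_bound_def using zero_less_one by blast
  from this[rule_format, OF A1_weight_one A1_weight_one]
  have N: "(\<integral>\<^sup>+ y. epowr (iter_norm j q (coord_max (Suc j) h) (x(Suc j := y))) ?r \<partial>lborel)
      \<le> ennreal N * (\<integral>\<^sup>+ y. epowr (iter_norm j q h (x(Suc j := y))) ?r \<partial>lborel)"
    if "h \<in> borel_measurable points" for h x
    using that by (fastforce simp: norm_sections_def factored_weight_def)
  show ?thesis
  proof (intro exI ballI allI)
    fix h :: "(nat \<Rightarrow> real) \<Rightarrow> ennreal" and x assume h: "h \<in> borel_measurable points"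
    have "epowr (ennreal N) (1 / ?r) = ennreal (enn2real (epowr (ennreal N) (1 / ?r)))"
      by simp
    moreover have "iter_norm (Suc j) q (coord_max (Suc j) h) x \<le> epowr (ennreal N) (1 / ?r) * iter_norm (Suc j) q h x"
      using epowr_mono[OF N[OF h, of x], of "1 / ?r"] r by (simp add: epowr_mult)
    ultimately show "iter_norm (Suc j) q (coord_max (Suc j) h) x
        \<le> ennreal (enn2real (epowr (ennreal N) (1 / ?r))) * iter_norm (Suc j) q h x"
      by simp
  qed
qed

primrec coord_max_iter :: "nat \<Rightarrow> ((nat \<Rightarrow> real) \<Rightarrow> ennreal) \<Rightarrow> (nat \<Rightarrow> real) \<Rightarrow> ennreal" where
  "coord_max_iter 0 h = h"
| "coord_max_iter (Suc k) h = coord_max (Suc k) (coord_max_iter k h)"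

lemma measurable_coord_max_iter [measurable]:
  "h \<in> borel_measurable points \<Longrightarrow> coord_max_iter k h \<in> borel_measurable points"
  by (induction k) auto

lemma coord_max_iter_bound:
  assumes q: "\<And>i. i \<in> {1..n} \<Longrightarrow> 1 < q i" and "k \<le> n"
  shows "\<exists>C::real. 0 < C \<and> (\<forall>h\<in>borel_measurable points. \<forall>x.
    iter_norm n q (coord_max_iter k h) x \<le> ennreal C * iter_norm n q h x)"
  using assms(2)
proof (induction k)
  case (Suc k)
  then obtain C where C: "0 < C" "\<And>h x. h \<in> borel_measurable points \<Longrightarrow>
      iter_norm n q (coord_max_iter k h) x \<le> ennreal C * iter_norm n q h x" by auto
  obtain D where D: "\<And>h x. h \<in> borel_measurable points \<Longrightarrow>
      iter_norm (Suc k) q (coord_max (Suc k) h) x \<le> ennreal D * iter_norm (Suc k) q h x"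
    using coord_max_iter_norm_bound[of k q] q Suc.prems by fastforce
  have q0: "0 < q i" if "i \<in> {1..n}" for i using q[OF that] by simp
  show ?case
  proof (intro exI conjI ballI allI)
    show "0 < max 1 D * C" using C by simp
    fix h :: "(nat \<Rightarrow> real) \<Rightarrow> ennreal" and x assume h: "h \<in> borel_measurable points"
    have "iter_norm n q (coord_max_iter (Suc k) h) x \<le> ennreal D * iter_norm n q (coord_max_iter k h) x"
      unfolding coord_max_iter.simps
      by (rule iter_norm_le_cmult[where k = "Suc k"]) (use h Suc.prems q0 in \<open>auto intro!: D measurable_coord_max_iter simp del: iter_norm.simps\<close>)
    also have "\<dots> \<le> ennreal (max 1 D) * (ennreal C * iter_norm n q h x)"
      by (intro mult_mono C h) (auto intro: ennreal_leI)
    finally show "iter_norm n q (coord_max_iter (Suc k) h) x \<le> ennreal (max 1 D * C) * iter_norm n q h x"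
      using C by (simp add: ennreal_mult mult.assoc)
  qed
qed (auto intro!: exI[of _ 1])


section \<open>Passing to Borel functions and to the intervals of the maximal operator\<close>

text \<open>
  An interval \<open>I\<close> of finite measure lies in slightly longer open intervals with rational endpoints; letting
  their length tend to \<open>|I|\<close> shows that no other intervals are needed.
\<close>

lemma interval_average_le_maxf:
  assumes I: "is_interval I" "x \<in> I" "0 < emeasure lebesgue I" "emeasure lebesgue I < \<infinity>"
  shows "(\<integral>\<^sup>+ y \<in> I. g y \<partial>lebesgue) / emeasure lebesgue I \<le> maxf lborel g x"
proof -
  obtain m where m: "emeasure lebesgue I = ennreal m" "0 < m"
  proof (cases "emeasure lebesgue I")
    case (real m)
    with I(3) that[of m] show ?thesis by simp
  qed (use I(4) in simp)
  have I_lb: "I \<in> sets lebesgue"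
  proof (rule ccontr)
    assume "I \<notin> sets lebesgue"
    then have "emeasure lebesgue I = 0" by (rule emeasure_notin_sets)
    with m show False by simp
  qed
  have sub: "{c..d} \<subseteq> I" if "c \<in> I" "d \<in> I" for c d
    using I(1) that unfolding is_interval_1 by (meson atLeastAtMost_iff subsetI)
  have len: "d - c \<le> m" if "c \<in> I" "d \<in> I" for c d
  proof (cases "c \<le> d")
    case True
    have "emeasure lebesgue {c..d} \<le> emeasure lebesgue I"
      using sub[OF that] I_lb by (rule emeasure_mono)
    then show ?thesis using True m by (simp add: ennreal_le_iff)
  qed (use m in simp)
  have bdd: "bdd_below I" "bdd_above I"
    using len[OF I(2)] len[OF _ I(2)] by (auto simp: bdd_below_def bdd_above_def algebra_simps)
       (metis add.commute diff_le_eq le_diff_eq)+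
  define a where "a = Inf I"
  define b where "b = Sup I"
  have ab: "a \<le> y" "y \<le> b" if "y \<in> I" for y
    using that bdd by (auto simp: a_def b_def intro: cInf_lower cSup_upper)
  have ba: "b - a \<le> m"
  proof -
    have "b - m \<le> y" if "y \<in> I" for y
    proof -
      have "b \<le> y + m" unfolding b_def using I(2) len[OF that] by (intro cSup_least) (auto simp: algebra_simps)
      then show ?thesis by simp
    qed
    then have "b - m \<le> a" unfolding a_def using I(2) by (intro cInf_greatest) auto
    then show ?thesis by simp
  qed
  show ?thesis
  proof (cases "maxf lborel g x")
    case (real M)
    have "(\<integral>\<^sup>+ y \<in> I. g y \<partial>lebesgue) \<le> ennreal (M * m)"
    proof (rule ennreal_le_epsilon)
      fix e :: real assume e: "0 < e"
      define \<delta> where "\<delta> = e / (2 * (M + 1))"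
      have \<delta>: "0 < \<delta>" "M * (2 * \<delta>) \<le> e" using e real by (auto simp: \<delta>_def field_simps)
      obtain a' where a': "a' \<in> \<rat>" "a - \<delta> < a'" "a' < a" using Rats_dense_in_real[of "a - \<delta>" a] \<delta> by auto
      obtain b' where b': "b' \<in> \<rat>" "b < b'" "b' < b + \<delta>" using Rats_dense_in_real[of b "b + \<delta>"] \<delta> by auto
      have x: "x \<in> {a'<..<b'}" using ab[OF I(2)] a' b' by auto
      then have lt: "a' < b'" by simp
      have "(\<integral>\<^sup>+ y \<in> I. g y \<partial>lebesgue) \<le> (\<integral>\<^sup>+ y \<in> {a'<..<b'}. g y \<partial>lborel)"
        unfolding nn_integral_completion using ab a' b'
        by (intro nn_integral_mono) (force simp: indicator_def)
      also have "\<dots> = (\<integral>\<^sup>+ y \<in> {a'<..<b'}. g y \<partial>lborel) / emeasure lborel {a'<..<b'} * ennreal (b' - a')"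
        using lt by (simp add: ennreal_divide_times ennreal_divide_self)
      also have "\<dots> \<le> ennreal M * ennreal (b' - a')"
        using average_le_maxf[OF a'(1) b'(1) x, of lborel g] real by (intro mult_right_mono) auto
      also have "\<dots> = ennreal (M * (b' - a'))"
        using real lt by (simp add: ennreal_mult)
      also have "M * (b' - a') \<le> M * m + e"
      proof -
        have "M * (b' - a') \<le> M * (m + 2 * \<delta>)" using a' b' ba real by (intro mult_left_mono) auto
        with \<delta> show ?thesis by (simp add: distrib_left)
      qed
      finally show "(\<integral>\<^sup>+ y \<in> I. g y \<partial>lebesgue) \<le> ennreal (M * m) + ennreal e"
        using real m e by (simp add: ennreal_leI)
    qed
    then have "(\<integral>\<^sup>+ y \<in> I. g y \<partial>lebesgue) / emeasure lebesgue I \<le> ennreal (M * m) / ennreal m"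
      unfolding m by (rule divide_right_mono_ennreal)
    also have "\<dots> = ennreal M" using m real by (simp add: divide_ennreal)
    finally show ?thesis using real by simp
  qed simp
qed

lemma maximal_op_le: "maximal_op k g x \<le> maxf lborel (\<lambda>y. g (x(k := y))) (x k)"
  unfolding maximal_op_def by (intro SUP_least interval_average_le_maxf) auto

lemma iter_norm_one_eq_integral:
  assumes [measurable]: "G \<in> borel_measurable points"
  shows "iter_norm k (\<lambda>_. 1) G x = (\<integral>\<^sup>+ z. G (\<lambda>i. if i \<in> {1..k} then z i else x i) \<partial>PiM {1..k} (\<lambda>_. lborel))"
proof (induction k arbitrary: x)
  case 0
  show ?case by (simp add: PiM_empty nn_integral_count_space_finite)
next
  case (Suc k)
  interpret product_sigma_finite "\<lambda>_. lborel" ..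
  have upd: "(\<lambda>i. if i \<in> {1..k} then z i else (x(Suc k := y)) i)
    = (\<lambda>i. if i \<in> {1..Suc k} then (z(Suc k := y)) i else x i)" for z :: "nat \<Rightarrow> real" and y
    by (auto simp: fun_eq_iff)
  have merge: "(\<lambda>z i. if i \<in> {1..Suc k} then z i else x i) \<in> PiM (insert (Suc k) {1..k}) (\<lambda>_. lborel) \<rightarrow>\<^sub>M points"
  proof (rule measurable_PiM_single')
    fix i
    show "(\<lambda>z. if i \<in> {1..Suc k} then z i else x i) \<in> PiM (insert (Suc k) {1..k}) (\<lambda>_. lborel) \<rightarrow>\<^sub>M borel"
    proof (cases "i \<in> {1..Suc k}")
      case True
      then have "i \<in> insert (Suc k) {1..k}" by auto
      from measurable_component_singleton[OF this, of "\<lambda>_. lborel"] True show ?thesis by simp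
    next
      case False
      then have "(\<lambda>z. if i \<in> {1..Suc k} then z i else x i) = (\<lambda>_. x i)" by (simp only: if_False)
      then show ?thesis by simp
    qed
  qed auto
  have "(\<integral>\<^sup>+ z. G (\<lambda>i. if i \<in> {1..Suc k} then z i else x i) \<partial>PiM (insert (Suc k) {1..k}) (\<lambda>_. lborel))
    = (\<integral>\<^sup>+ y. (\<integral>\<^sup>+ z. G (\<lambda>i. if i \<in> {1..Suc k} then (z(Suc k := y)) i else x i) \<partial>PiM {1..k} (\<lambda>_. lborel)) \<partial>lborel)"
    by (rule product_nn_integral_insert_rev[OF _ _ measurable_compose[OF merge assms]]) auto
  also have "\<dots> = iter_norm (Suc k) (\<lambda>_. 1) G x"
    unfolding upd[symmetric] by (simp add: Suc.IH)
  also have "insert (Suc k) {1..k} = {1..Suc k}" by auto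
  finally show ?case ..
qed

text \<open>
  The exceptional null set, extended to all of \<open>nat \<Rightarrow> real\<close>, is recorded by its indicator \<open>J\<close>: its
  iterated integrals are what interacts with the recursive definitions of the norm and of the maximal
  operators.
\<close>

lemma borel_representative:
  fixes \<phi> :: "(nat \<Rightarrow> real) \<Rightarrow> ennreal"
  assumes "\<phi> \<in> borel_measurable (lebesgue_pow n)"
  obtains g J where "g \<in> borel_measurable points" "J \<in> borel_measurable points"
    "\<And>x. x \<in> extensional {1..n} \<Longrightarrow> J x = 0 \<Longrightarrow> \<phi> x = g x"
    "\<And>x. iter_norm n (\<lambda>_. 1) J x = 0"
proof -
  let ?P = "PiM {1..n} (\<lambda>_. lborel :: real measure)"
  obtain g' where g': "g' \<in> borel_measurable ?P" and ae: "AE x in ?P. \<phi> x = g' x"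
    using completion_ex_borel_measurable[of \<phi> ?P] assms unfolding lebesgue_pow_def by blast
  from ae obtain N where N: "N \<in> null_sets ?P" "{x \<in> space ?P. \<phi> x \<noteq> g' x} \<subseteq> N"
    by (auto elim!: AE_E simp: null_sets_def)
  have restr: "(\<lambda>x. restrict x {1..n}) \<in> points \<rightarrow>\<^sub>M ?P"
    by (rule measurable_restrict_subset') auto
  define g where "g = (\<lambda>x. g' (restrict x {1..n}))"
  define J where "J = (\<lambda>x. indicator N (restrict x {1..n}) :: ennreal)"
  have J: "J \<in> borel_measurable points"
    unfolding J_def using N by (intro measurable_compose[OF restr]) auto
  show thesis
  proof (rule that[of g J])
    show "g \<in> borel_measurable points" unfolding g_def by (rule measurable_compose[OF restr g'])
    show "J \<in> borel_measurable points" by (rule J)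
    show "\<phi> x = g x" if "x \<in> extensional {1..n}" "J x = 0" for x
      using that N(2) by (auto simp: J_def g_def extensional_restrict space_PiM PiE_def)
    show "iter_norm n (\<lambda>_. 1) J x = 0" for x
    proof -
      have "iter_norm n (\<lambda>_. 1) J x = (\<integral>\<^sup>+ z. indicator N z \<partial>?P)"
        unfolding iter_norm_one_eq_integral[OF J]
      proof (rule nn_integral_cong)
        fix z assume "z \<in> space ?P"
        then have "restrict (\<lambda>i. if i \<in> {1..n} then z i else x i) {1..n} = z"
          by (auto simp: space_PiM PiE_def extensional_def fun_eq_iff)
        then show "J (\<lambda>i. if i \<in> {1..n} then z i else x i) = indicator N z"
          by (simp add: J_def)
      qed
      also have "\<dots> = 0" using N by (auto simp: null_sets_def)
      finally show ?thesis .
    qed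
  qed
qed

text \<open>
  Read with \<open>J\<close> the indicator of a null set: a point that is not exceptional at stage \<open>k + 1\<close> is not
  exceptional at stage \<open>k\<close> for almost every value of the coordinate treated at that stage. At stage \<open>n\<close>
  there are no exceptional points.
\<close>

lemma AE_iter_norm_section_eq_0:
  assumes "J \<in> borel_measurable points" and "iter_norm (Suc k) (\<lambda>_. 1) J x = 0"
  shows "AE y in lborel. iter_norm k (\<lambda>_. 1) J (x(Suc k := y)) = 0"
proof -
  note [measurable] = measurable_section[OF measurable_iter_norm[OF assms(1)]]
  show ?thesis using assms(2) by (simp add: nn_integral_0_iff_AE)
qed

lemma extensional_upd: "x \<in> extensional I \<Longrightarrow> k \<in> I \<Longrightarrow> x(k := y) \<in> extensional I"
  by (auto simp: extensional_def)

lemma iter_norm_le_of_null: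
  assumes J: "J \<in> borel_measurable points"
    and eq: "\<And>x. x \<in> extensional {1..n} \<Longrightarrow> J x = 0 \<Longrightarrow> \<psi> x \<le> \<phi> x"
    and q: "\<And>i. i \<in> {1..n} \<Longrightarrow> 0 < q i"
    and "k \<le> n" "x \<in> extensional {1..n}" "iter_norm k (\<lambda>_. 1) J x = 0"
  shows "iter_norm k q \<psi> x \<le> iter_norm k q \<phi> x"
  using assms(4-6)
proof (induction k arbitrary: x)
  case (Suc k)
  have "AE y in lborel. iter_norm k q \<psi> (x(Suc k := y)) \<le> iter_norm k q \<phi> (x(Suc k := y))"
    using AE_iter_norm_section_eq_0[OF J Suc.prems(3)]
    by eventually_elim (use Suc.prems in \<open>auto intro!: Suc.IH extensional_upd\<close>)
  moreover have "0 < q (Suc k)" using q Suc.prems by simp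
  ultimately show ?case
    by (auto intro!: epowr_mono nn_integral_mono_AE elim!: eventually_mono)
qed (use eq in auto)

lemma maximal_iter_le_of_null:
  assumes J: "J \<in> borel_measurable points"
    and eq: "\<And>x. x \<in> extensional {1..n} \<Longrightarrow> J x = 0 \<Longrightarrow> \<phi> x = g x"
    and "k \<le> n" "x \<in> extensional {1..n}" "iter_norm k (\<lambda>_. 1) J x = 0"
  shows "maximal_iter k \<phi> x \<le> coord_max_iter k g x"
  using assms(3-5)
proof (induction k arbitrary: x)
  case (Suc k)
  have "AE y in lborel. maximal_iter k \<phi> (x(Suc k := y)) \<le> coord_max_iter k g (x(Suc k := y))"
    using AE_iter_norm_section_eq_0[OF J Suc.prems(3)]
    by eventually_elim (use Suc.prems in \<open>auto intro!: Suc.IH extensional_upd\<close>)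
  then show ?case
    by (simp add: coord_max_def order_trans[OF maximal_op_le maxf_mono_AE])
qed (use eq in auto)

text \<open>
  The norm of \<open>G\<^bsup>1/t\<^esup>\<close> with exponents \<open>p\<^sub>i\<close> is the \<open>1/t\<close>-th power of the norm of \<open>G\<close> with exponents
  \<open>p\<^sub>i / t\<close>.
\<close>

lemma partial_norm_power:
  assumes t: "0 < t" and "\<And>i. i \<in> {1..k} \<Longrightarrow> 0 < p i \<and> p i < \<infinity>"
  shows "partial_norm k p (\<lambda>z. epowr (G z) (1 / t)) x
    = epowr (iter_norm k (\<lambda>i. enn2real (p i) / t) G x) (1 / t)"
  using assms(2)
proof (induction k arbitrary: x)
  case (Suc k)
  have "p (Suc k) \<noteq> \<infinity>" "0 < enn2real (p (Suc k))"
    using Suc.prems[of "Suc k"] by (auto simp: enn2real_positive_iff)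
  with Suc t show ?case by (simp add: Lp_norm1_def nn_integral_completion epowr_epowr)
qed simp

theorem theorem1p2:
  fixes n :: nat and p :: "nat \<Rightarrow> ennreal" and t :: real
  assumes "n \<ge> 1"
    and "\<And>i. i \<in> {1..n} \<Longrightarrow> 0 < p i \<and> p i < \<infinity>"
    and "0 < t" and "ennreal t < Min (p ` {1..n})"
  shows "\<exists>C::real. C > 0 \<and>
    (\<forall>f \<in> mixed_Lebesgue n p.
       mixed_norm n p (iterated_maximal n t f)
         \<le> ennreal C * mixed_norm n p (\<lambda>x. ennreal (cmod (f x))))"
proof -
  define q where "q = (\<lambda>i. enn2real (p i) / t)"
  have q: "1 < q i" if "i \<in> {1..n}" for i
  proof -
    have "ennreal t < p i" using assms(4) that by (subst (asm) Min_gr_iff) auto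
    moreover have "p i = ennreal (enn2real (p i))" using assms(2)[OF that] by simp
    ultimately have "t < enn2real (p i)" using assms(3) by (metis ennreal_less_iff less_imp_le)
    then show ?thesis using assms(3) by (simp add: q_def)
  qed
  obtain C where C: "0 < C" "\<And>h x. h \<in> borel_measurable points \<Longrightarrow>
      iter_norm n q (coord_max_iter n h) x \<le> ennreal C * iter_norm n q h x"
    using coord_max_iter_bound[of n q n] q by auto
  show ?thesis
  proof (intro exI[of _ "C powr (1 / t)"] conjI ballI)
    show "0 < C powr (1 / t)" using C by simp
    fix f assume "f \<in> mixed_Lebesgue n p"
    then have f [measurable]: "f \<in> borel_measurable (lebesgue_pow n)" by (simp add: mixed_Lebesgue_def)
    define \<phi> where "\<phi> = (\<lambda>z. ennreal (cmod (f z) powr t))"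
    have "\<phi> \<in> borel_measurable (lebesgue_pow n)" unfolding \<phi>_def by measurable
    then obtain g J where g: "g \<in> borel_measurable points" and J: "J \<in> borel_measurable points"
      and eq: "\<And>x. x \<in> extensional {1..n} \<Longrightarrow> J x = 0 \<Longrightarrow> \<phi> x = g x"
      and null: "\<And>x. iter_norm n (\<lambda>_. 1) J x = 0"
      using borel_representative by blast
    let ?o = "\<lambda>_::nat. undefined :: real"
    have q0: "0 < q i" if "i \<in> {1..n}" for i using q[OF that] by simp
    have o: "?o \<in> extensional {1..n}" by (simp add: extensional_def)
    have le: "maximal_iter n \<phi> x \<le> coord_max_iter n g x" if "x \<in> extensional {1..n}" for x
      by (rule maximal_iter_le_of_null[OF J eq order_refl that null])
    have "iter_norm n q (maximal_iter n \<phi>) ?o \<le> iter_norm n q (coord_max_iter n g) ?o"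
      by (rule iter_norm_le_of_null[OF J le q0 order_refl o null])
    also have "\<dots> \<le> ennreal C * iter_norm n q g ?o" by (rule C(2)[OF g])
    also have "\<dots> \<le> ennreal C * iter_norm n q \<phi> ?o"
      using eq by (intro mult_left_mono iter_norm_le_of_null[OF J _ q0 order_refl o null]) auto
    finally have "epowr (iter_norm n q (maximal_iter n \<phi>) ?o) (1 / t)
        \<le> epowr (ennreal C * iter_norm n q \<phi> ?o) (1 / t)"
      using assms(3) by (intro epowr_mono) auto
    also have "\<dots> = ennreal (C powr (1 / t)) * epowr (iter_norm n q \<phi> ?o) (1 / t)"
      using C by (simp add: epowr_mult epowr_ennreal)
    also have "epowr (iter_norm n q (maximal_iter n \<phi>) ?o) (1 / t) = mixed_norm n p (iterated_maximal n t f)"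
      using partial_norm_power[OF assms(3,2), where k = n and G = "maximal_iter n \<phi>" and x = ?o]
      by (simp add: mixed_norm_def iterated_maximal_def[abs_def] \<phi>_def q_def)
    also have "epowr (iter_norm n q \<phi> ?o) (1 / t) = mixed_norm n p (\<lambda>x. ennreal (cmod (f x)))"
      using partial_norm_power[OF assms(3,2), where k = n and G = \<phi> and x = ?o] assms(3)
      by (simp add: mixed_norm_def \<phi>_def q_def epowr_ennreal powr_powr)
    finally show "mixed_norm n p (iterated_maximal n t f)
        \<le> ennreal (C powr (1 / t)) * mixed_norm n p (\<lambda>x. ennreal (cmod (f x)))" .
  qed
qed

end
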